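(* Let $S_1,S_2$ be two $h$-tiled sets with underlying simplicial complexes $K_1,K_2$, and let the edges of $K_1$ and $K_2$ be oriented so that no triangle has boundary an oriented one-cycle, so that the vertices of each simplex of $K_1$ and $K_2$ inherit a total order. Assume that: (a) if the tiling of $S_1$ contains a tile which has been deprived both of its facet not containing its biggest vertex and of its facet not containing its least vertex, then every tile of $S_2$ has been deprived either of its facet not containing its biggest vertex or of its facet not containing its least vertex; and (b) the same holds with the roles of $S_1$ and $S_2$ exchanged. Then the product tiling of $S_1\times S_2$ (defined in the context) is an $h$-tiling.
   Context: A facet of a simplex is a codimension one face (the empty set is regarded as the unique facet of a $0$-simplex). A basic tile of dimension $n$ and order $k$ is a closed $n$-simplex deprived of $k$ of its facets. An $h$-tiling of a subset $S$ of the underlying space $|K|$ of a finite simplicial complex $K$ is a partition of $S$ by basic tiles, each obtained from a simplex of $K$ (its underlying simplex), such that for every $j\ge 0$ the union of tiles of dimension $\ge j$ is closed in $S$; the closure of $S$ is the underlying simplicial complex. An $h$-tiled set is a set equipped with an $h$-tiling. The total order on the vertices of a simplex: $x\le y$ iff $x=y$ or the edge between $x$ and $y$ is oriented from $x$ to $y$. Staircases. Write $[n]=\{0,\dots,n\}$; $\Delta_{[n]}$ is the simplex with vertices labelled by $[n]$. Let $I(n,m)$ be the set of collections $I=(I_j)_{0\le j\le n}$ of non-empty intervals $I_j=\{b_I(j),\dots,e_I(j)\}\subset[m]$ with $b_I(0)=0$, $e_I(n)=m$ and $e_I(j)=b_I(j+1)$ for $0\le j<n$. Let $\Delta_I\subset\Delta_{[n]}\times\Delta_{[m]}$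 be the $(m+n)$-simplex with vertices $(j,i)$, $j\in[n]$, $i\in I_j$, and let $T_I$ be $\Delta_I$ deprived, for every $j<n$ with $b_I(j)\ne e_I(j)$, of its facet not containing $(j,e_I(j))$. Let $P$ be the automorphism of $\Delta_{[n]}\times\Delta_{[m]}$ induced by $j\mapsto n-j$, $i\mapsto m-i$ on vertices. The total orders identify the simplices of $K_1$ and $K_2$ with standard ones, and the resulting triangulations $(\Delta_I)_{I\in I(n,m)}$ of all products of a simplex of $K_1$ and a simplex of $K_2$ glue to a triangulation of $K_1\times K_2$ with the same vertices. Product tiling. For each tile $T$ of $S_1$ and each tile $T'$ of $S_2$, of dimensions $n$ and $m$, let $J_1\subset[n]$ (resp. $J_2\subset[m]$) be the set of labels of those vertices of the underlying simplex whose opposite facet has been removed in $T$ (resp. $T'$). Decompose $T\times T'$ into the pieces $\big(T_I\cap(T\times T')\big)_{I\in I(n,m)}$ if both implications ($n\in J_1\Rightarrow m\in J_2$) and ($0\in J_2\Rightarrow 0\in J_1$) hold, and into the pieces $\big(P(T_I)\cap(T\times T')\big)_{I\in I(n,m)}$ otherwise. The product tiling of $S_1\times S_2$ is the collection of all these pieces over all pairs $(T,T')$, in the triangulation of $K_1\times K_2$ obtained by gluing the triangulations $(\Delta_I)_{I\in I(n,m)}$ of all products of a simplex of $K_1$ and a simplex of $K_2$. *)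

theory Defs
  imports "HOL-Analysis.Analysis"
begin

section \<open>Basic tiles and h-tilings\<close>

text \<open>Finite simplicial complexes are the geometric ones of the library; their elements are closed
  simplices, and a nonempty complex also contains the empty set, the face of dimension -1.\<close>

definition verts :: "'a::euclidean_space set \<Rightarrow> 'a set" where
  "verts \<sigma> = {v. v extreme_point_of \<sigma>}"

text \<open>Unlike the library's \<^const>\<open>facet_of\<close>, this allows the empty set, which is thereby the unique
  facet of a 0-simplex.\<close>

definition simplex_facet :: "'a::euclidean_space set \<Rightarrow> 'a set \<Rightarrow> bool" where
  "simplex_facet F \<sigma> \<longleftrightarrow> F face_of \<sigma> \<and> aff_dim F = aff_dim \<sigma> - 1"

definition opposite_facet :: "'a::euclidean_space set \<Rightarrow> 'a \<Rightarrow> 'a set" where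
  "opposite_facet \<sigma> v = convex hull (verts \<sigma> - {v})"

text \<open>A tile is recorded together with its removed facets, because removing the empty facet of a
  0-simplex changes the order of the tile but not its set of points.\<close>

datatype 'a tile = Tile (underlying: "'a set") (removed: "'a set set")

definition basic_tile :: "nat \<Rightarrow> nat \<Rightarrow> 'a::euclidean_space tile \<Rightarrow> bool" where
  "basic_tile n k t \<longleftrightarrow>
     int n simplex underlying t \<and> (\<forall>F\<in>removed t. simplex_facet F (underlying t)) \<and>
     card (removed t) = k"

definition points :: "'a tile \<Rightarrow> 'a set" where
  "points t = underlying t - \<Union> (removed t)"

definition tile_dim :: "'a::euclidean_space tile \<Rightarrow> nat" where
  "tile_dim t = nat (aff_dim (underlying t))"

definition h_tiling ::
  "'a::euclidean_space set set \<Rightarrow> 'a set \<Rightarrow> 'a tile set \<Rightarrow> bool" where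
  "h_tiling K S \<T> \<longleftrightarrow>
     simplicial_complex K \<and> S \<subseteq> \<Union>K \<and>
     (\<forall>t\<in>\<T>. underlying t \<in> K \<and> (\<exists>n k. basic_tile n k t)) \<and>
     pairwise (\<lambda>t t'. disjnt (points t) (points t')) \<T> \<and>
     \<Union> (points ` \<T>) = S \<and>
     (\<forall>j. closedin (top_of_set S) (\<Union> (points ` {t\<in>\<T>. j \<le> tile_dim t})))"

definition h_tiled_set ::
  "'a::euclidean_space set set \<Rightarrow> 'a set \<Rightarrow> 'a tile set \<Rightarrow> bool" where
  "h_tiled_set K S \<T> \<longleftrightarrow> h_tiling K S \<T> \<and> closure S = \<Union>K"


section \<open>Oriented edges and the induced orders\<close>

definition edge_orientation ::
  "'a::euclidean_space set set \<Rightarrow> ('a \<times> 'a) set \<Rightarrow> bool" where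
  "edge_orientation K A \<longleftrightarrow>
     A \<subseteq> {(x, y). x \<noteq> y \<and> closed_segment x y \<in> K} \<and>
     (\<forall>x y. x \<noteq> y \<and> closed_segment x y \<in> K \<longrightarrow> ((x, y) \<in> A \<longleftrightarrow> (y, x) \<notin> A))"

definition no_cyclic_triangle ::
  "'a::euclidean_space set set \<Rightarrow> ('a \<times> 'a) set \<Rightarrow> bool" where
  "no_cyclic_triangle K A \<longleftrightarrow>
     (\<forall>x y z. 2 simplex (convex hull {x, y, z}) \<and> convex hull {x, y, z} \<in> K \<longrightarrow>
        \<not> ((x, y) \<in> A \<and> (y, z) \<in> A \<and> (z, x) \<in> A))"

definition vle :: "('a \<times> 'a) set \<Rightarrow> 'a \<Rightarrow> 'a \<Rightarrow> bool" where
  "vle A x y \<longleftrightarrow> x = y \<or> (x, y) \<in> A"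

definition is_least :: "('a::euclidean_space \<times> 'a) set \<Rightarrow> 'a set \<Rightarrow> 'a \<Rightarrow> bool" where
  "is_least A \<sigma> v \<longleftrightarrow> v \<in> verts \<sigma> \<and> (\<forall>u\<in>verts \<sigma>. vle A v u)"

definition is_biggest :: "('a::euclidean_space \<times> 'a) set \<Rightarrow> 'a set \<Rightarrow> 'a \<Rightarrow> bool" where
  "is_biggest A \<sigma> v \<longleftrightarrow> v \<in> verts \<sigma> \<and> (\<forall>u\<in>verts \<sigma>. vle A u v)"

definition least_deprived :: "('a::euclidean_space \<times> 'a) set \<Rightarrow> 'a tile \<Rightarrow> bool" where
  "least_deprived A t \<longleftrightarrow>
     (\<exists>v. is_least A (underlying t) v \<and> opposite_facet (underlying t) v \<in> removed t)"

definition biggest_deprived :: "('a::euclidean_space \<times> 'a) set \<Rightarrow> 'a tile \<Rightarrow> bool" where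
  "biggest_deprived A t \<longleftrightarrow>
     (\<exists>v. is_biggest A (underlying t) v \<and> opposite_facet (underlying t) v \<in> removed t)"

text \<open>The identification of the vertices of a simplex with 0, ..., n: the label of a vertex is the
  number of strictly smaller vertices.\<close>

definition label :: "('a::euclidean_space \<times> 'a) set \<Rightarrow> 'a set \<Rightarrow> 'a \<Rightarrow> nat" where
  "label A \<sigma> v = card {u \<in> verts \<sigma>. vle A u v \<and> u \<noteq> v}"

definition vertex_at :: "('a::euclidean_space \<times> 'a) set \<Rightarrow> 'a set \<Rightarrow> nat \<Rightarrow> 'a" where
  "vertex_at A \<sigma> = inv_into (verts \<sigma>) (label A \<sigma>)"

definition removed_labels :: "('a::euclidean_space \<times> 'a) set \<Rightarrow> 'a tile \<Rightarrow> nat set" where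
  "removed_labels A t =
     label A (underlying t) `
       {v \<in> verts (underlying t). opposite_facet (underlying t) v \<in> removed t}"


section \<open>Staircases and the product tiling\<close>

text \<open>A collection of intervals is given by the pair of its endpoint functions: the j-th interval is
  \<open>{b j..e j}\<close>. Values beyond n are irrelevant.\<close>

definition staircases :: "nat \<Rightarrow> nat \<Rightarrow> ((nat \<Rightarrow> nat) \<times> (nat \<Rightarrow> nat)) set" where
  "staircases n m =
     {(b, e). (\<forall>j\<le>n. b j \<le> e j \<and> e j \<le> m) \<and> b 0 = 0 \<and> e n = m \<and> (\<forall>j<n. e j = b (j + 1))}"

text \<open>Below, \<open>v\<close> and \<open>w\<close> enumerate the vertices of the two factors, so that \<open>(v j, w i)\<close> is the vertex
  labelled \<open>(j, i)\<close> of the product.\<close>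

definition stair_simplex ::
  "nat \<Rightarrow> (nat \<Rightarrow> 'a) \<Rightarrow> (nat \<Rightarrow> 'b) \<Rightarrow> (nat \<Rightarrow> nat) \<times> (nat \<Rightarrow> nat)
     \<Rightarrow> ('a::euclidean_space \<times> 'b::euclidean_space) set" where
  "stair_simplex n v w = (\<lambda>(b, e). convex hull {(v j, w i) | j i. j \<le> n \<and> i \<in> {b j..e j}})"

definition stair_tile ::
  "nat \<Rightarrow> (nat \<Rightarrow> 'a) \<Rightarrow> (nat \<Rightarrow> 'b) \<Rightarrow> (nat \<Rightarrow> nat) \<times> (nat \<Rightarrow> nat)
     \<Rightarrow> ('a::euclidean_space \<times> 'b::euclidean_space) set" where
  "stair_tile n v w = (\<lambda>(b, e).
     stair_simplex n v w (b, e) -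
       (\<Union>j\<in>{j. j < n \<and> b j \<noteq> e j}. opposite_facet (stair_simplex n v w (b, e)) (v j, w (e j))))"

text \<open>All faces of the staircase simplices of products of nonempty simplices.\<close>

definition product_complex ::
  "'a::euclidean_space set set \<Rightarrow> ('a \<times> 'a) set \<Rightarrow> 'b::euclidean_space set set \<Rightarrow> ('b \<times> 'b) set
     \<Rightarrow> ('a \<times> 'b) set set" where
  "product_complex K1 A1 K2 A2 =
     {F. \<exists>\<sigma> \<tau> n m. \<exists>I\<in>staircases n m.
        \<sigma> \<in> K1 \<and> int n simplex \<sigma> \<and> \<tau> \<in> K2 \<and> int m simplex \<tau> \<and>
        F face_of stair_simplex n (vertex_at A1 \<sigma>) (vertex_at A2 \<tau>) I}"

text \<open>In the second case, reversing both enumerations gives the images of the \<^const>\<open>stair_tile\<close>s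
  under the automorphism of the product induced by \<open>j \<mapsto> n - j\<close> and \<open>i \<mapsto> m - i\<close> on vertices.\<close>

definition product_pieces ::
  "('a::euclidean_space \<times> 'a) set \<Rightarrow> 'a tile \<Rightarrow> ('b::euclidean_space \<times> 'b) set \<Rightarrow> 'b tile
     \<Rightarrow> ('a \<times> 'b) set set" where
  "product_pieces A1 t A2 t' =
    (let n = tile_dim t; m = tile_dim t';
         v = vertex_at A1 (underlying t); w = vertex_at A2 (underlying t');
         J1 = removed_labels A1 t; J2 = removed_labels A2 t'
     in if (n \<in> J1 \<longrightarrow> m \<in> J2) \<and> (0 \<in> J2 \<longrightarrow> 0 \<in> J1)
        then (\<lambda>I. stair_tile n v w I \<inter> (points t \<times> points t')) ` staircases n m
        else (\<lambda>I. stair_tile n (\<lambda>j. v (n - j)) (\<lambda>i. w (m - i)) I \<inter> (points t \<times> points t'))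
               ` staircases n m)"

definition product_tiling ::
  "('a::euclidean_space \<times> 'a) set \<Rightarrow> 'a tile set \<Rightarrow> ('b::euclidean_space \<times> 'b) set \<Rightarrow> 'b tile set
     \<Rightarrow> ('a \<times> 'b) set set" where
  "product_tiling A1 \<T>1 A2 \<T>2 = (\<Union>t\<in>\<T>1. \<Union>t'\<in>\<T>2. product_pieces A1 t A2 t')"

end

theory Submission
  imports Defs
begin

text \<open>A point of the product of two simplices is a pair of probability vectors \<open>x\<close>, \<open>y\<close> on the two vertex
sets, and writing it as a convex combination of the product vertices \<open>(v j, w i)\<close> amounts to choosing
a coupling of \<open>x\<close> and \<open>y\<close>. Among all couplings exactly one is supported on a chain of the product
order: cut an interval into consecutive pieces of lengths \<open>x 0, x 1, \<dots>\<close> and again into pieces of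
lengths \<open>y 0, y 1, \<dots>\<close>; the mass at \<open>(j, i)\<close> is the length of the overlap of the \<open>j\<close>-th piece of the
first subdivision with the \<open>i\<close>-th piece of the second. So every point of the product has a carrier, the
chain on which this coupling lives. A point lies in the hull of a chain iff its carrier is a subset of
that chain, and it avoids the facet opposite to \<open>v j\<close> iff its carrier meets column \<open>j\<close>
(\<open>carries_in_hull_iff\<close>, \<open>carries_fst_iff\<close>, \<open>carries_snd_iff\<close>). This turns the geometry into the
combinatorics of chains in a grid.

For a carrier \<open>C\<close> the point belongs to the staircase tile of \<open>I\<close> iff \<open>C\<close> lies in the staircase and
contains its corners, and every chain has exactly one such staircase; hence the tiles partition the
product. Deprive the factors of the facets labelled by \<open>J1\<close> and \<open>J2\<close>. The facet opposite to \<open>v j\<close> cuts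
the staircase simplex in a facet if column \<open>j\<close> of the staircase is a single cell. Otherwise it cuts a
smaller face, which must be contained in a facet that is removed anyway; a corner provides this facet
except in the last column. Likewise rows cause trouble only if they are the bottom row. In these two
places the implications \<open>n \<in> J1 \<longrightarrow> m \<in> J2\<close> and \<open>0 \<in> J2 \<longrightarrow> 0 \<in> J1\<close> provide it
(\<open>removed_cells_subset_iff\<close>). Reversing both orders exchanges the roles of first and last label, and
the two hypotheses on tiles deprived at both ends ensure that the implications hold before or
after reversal.

The product complex is simplicial because carriers do not depend on the chosen pair of simplices: the
carrier of a point with respect to two pairs is the one with respect to their common faces. Finally,
dimensions of tiles add up, so the part of dimension at least \<open>j\<close> of the product is a finite union of
products of parts of dimension at least \<open>p\<close> and \<open>j - p\<close>, which are closed.\<close>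

section \<open>Monotone couplings\<close>

text \<open>Two cells in the same column are always comparable in the product order, so only cells in different
  columns impose a condition.\<close>

definition stair_chain :: "(nat \<times> nat) set \<Rightarrow> bool" where
  "stair_chain C \<longleftrightarrow> (\<forall>j i j' i'. (j, i) \<in> C \<and> (j', i') \<in> C \<and> j < j' \<longrightarrow> i \<le> i')"

lemma stair_chain_subset: "stair_chain D \<Longrightarrow> C \<subseteq> D \<Longrightarrow> stair_chain C"
  unfolding stair_chain_def by blast

text \<open>The second difference of the joint distribution function \<open>min X Y\<close> of the monotone coupling of
  \<open>x\<close> and \<open>y\<close>; equivalently, the length of the overlap of the intervals of length \<open>x j\<close> and \<open>y i\<close>.\<close>

definition coupling :: "(nat \<Rightarrow> real) \<Rightarrow> (nat \<Rightarrow> real) \<Rightarrow> nat \<times> nat \<Rightarrow> real" where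
  "coupling x y = (\<lambda>(j, i).
     min (sum x {..<Suc j}) (sum y {..<Suc i}) - min (sum x {..<j}) (sum y {..<Suc i})
     - min (sum x {..<Suc j}) (sum y {..<i}) + min (sum x {..<j}) (sum y {..<i}))"

text \<open>Let \<open>L a b\<close> be the mass of the lower left corner \<open>{..<a} \<times> {..<b}\<close>. It can be smaller than both of
  its marginals only if there is mass above it and mass to the right of it, and two such cells are
  not comparable. So \<open>L\<close> is the minimum of the marginals, and \<open>l\<close> is recovered from \<open>L\<close> by
  inclusion-exclusion.\<close>

lemma coupling_unique:
  assumes nn: "\<And>j i. j \<le> n \<Longrightarrow> i \<le> m \<Longrightarrow> 0 \<le> l (j, i)"
    and chain: "stair_chain {c \<in> {..n} \<times> {..m}. l c \<noteq> 0}"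
    and x: "\<And>j. j \<le> n \<Longrightarrow> x j = (\<Sum>i\<le>m. l (j, i))"
    and y: "\<And>i. i \<le> m \<Longrightarrow> y i = (\<Sum>j\<le>n. l (j, i))"
    and ji: "j \<le> n" "i \<le> m"
  shows "l (j, i) = coupling x y (j, i)"
proof -
  define L where "L a b = sum l ({..<a} \<times> {..<b})" for a b
  have Lx: "sum x {..<a} = L a (Suc m)" if "a \<le> Suc n" for a
    using that by (simp add: L_def x sum.cartesian_product' lessThan_Suc_atMost)
  have Ly: "sum y {..<b} = L (Suc n) b" if "b \<le> Suc m" for b
  proof -
    have "sum y {..<b} = (\<Sum>i<b. \<Sum>j\<le>n. l (j, i))"
      using that by (simp add: y)
    also have "\<dots> = (\<Sum>j\<le>n. \<Sum>i<b. l (j, i))" by (rule sum.swap)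
    finally show ?thesis by (simp add: L_def sum.cartesian_product' lessThan_Suc_atMost)
  qed
  have min: "L a b = min (sum x {..<a}) (sum y {..<b})" if ab: "a \<le> Suc n" "b \<le> Suc m" for a b
  proof -
    have le: "L a b \<le> L a (Suc m)" "L a b \<le> L (Suc n) b"
      unfolding L_def using ab by (auto intro!: sum_mono2 nn)
    have "L a b = L a (Suc m) \<or> L a b = L (Suc n) b"
    proof (rule ccontr)
      assume neg: "\<not> ?thesis"
      have "\<exists>c \<in> {..<a} \<times> {..<Suc m} - {..<a} \<times> {..<b}. l c \<noteq> 0"
      proof (rule ccontr)
        assume "\<not> ?thesis"
        then have "L a b = L a (Suc m)"
          unfolding L_def using ab by (intro sum.mono_neutral_left) auto
        with neg show False by simp
      qed
      then obtain c1 where c1: "c1 \<in> {..<a} \<times> {..<Suc m} - {..<a} \<times> {..<b}" "l c1 \<noteq> 0" by blast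
      have "\<exists>c \<in> {..<Suc n} \<times> {..<b} - {..<a} \<times> {..<b}. l c \<noteq> 0"
      proof (rule ccontr)
        assume "\<not> ?thesis"
        then have "L a b = L (Suc n) b"
          unfolding L_def using ab by (intro sum.mono_neutral_left) auto
        with neg show False by simp
      qed
      then obtain c2 where c2: "c2 \<in> {..<Suc n} \<times> {..<b} - {..<a} \<times> {..<b}" "l c2 \<noteq> 0" by blast
      obtain j1 i1 j2 i2 where c: "c1 = (j1, i1)" "c2 = (j2, i2)" by force
      have "i1 \<le> i2"
        using c1 c2 ab unfolding c
        by (intro chain[unfolded stair_chain_def, rule_format, of j1 i1 j2 i2]) auto
      with c1 c2 show False by (auto simp: c)
    qed
    with le show ?thesis using Lx[OF ab(1)] Ly[OF ab(2)] by linarith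
  qed
  have "l (j, i) = L (Suc j) (Suc i) - L j (Suc i) - L (Suc j) i + L j i"
    by (simp add: L_def sum.cartesian_product')
  also have "\<dots> = coupling x y (j, i)"
    using ji by (simp add: min coupling_def del: sum.lessThan_Suc)
  finally show ?thesis .
qed

lemma coupling_nonneg:
  assumes "0 \<le> x j" "0 \<le> y i"
  shows "0 \<le> coupling x y (j, i)"
proof -
  have "0 \<le> min (p + a) (q + b) - min p (q + b) - min (p + a) q + min p q" if "0 \<le> a" "0 \<le> b"
    for p q a b :: real using that by (cases "p \<le> q") (auto simp: min_def)
  from this[OF assms, of "sum x {..<j}" "sum y {..<i}"] show ?thesis by (simp add: coupling_def)
qed

text \<open>Positive mass forces the open intervals of \<open>j\<close> and of \<open>i\<close> to overlap. Since intervals with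
  larger index lie further to the right, this makes the support a chain.\<close>

lemma coupling_positive_overlap:
  assumes "0 \<le> x j" "0 \<le> y i" "coupling x y (j, i) \<noteq> 0"
  shows "sum x {..<j} < sum y {..<Suc i}" "sum y {..<i} < sum x {..<Suc j}"
proof -
  have "p < q + b \<and> q < p + a"
    if "0 \<le> a" "0 \<le> b" "min (p + a) (q + b) - min p (q + b) - min (p + a) q + min p q \<noteq> 0"
    for p q a b :: real
  proof (rule ccontr)
    assume "\<not> ?thesis"
    then consider "q + b \<le> p" | "p + a \<le> q" by linarith
    then show False
    proof cases
      case 1
      then have "min (p + a) (q + b) = q + b" "min p (q + b) = q + b" "min (p + a) q = q" "min p q = q"
        using that(1,2) by linarith+
      then show False using that(3) by simp
    next
      case 2
      then have "min (p + a) (q + b) = p + a" "min p (q + b) = p" "min (p + a) q = p + a" "min p q = p"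
        using that(1,2) by linarith+
      then show False using that(3) by simp
    qed
  qed
  from this[OF assms(1,2) assms(3)[unfolded coupling_def prod.case sum.lessThan_Suc]]
  show "sum x {..<j} < sum y {..<Suc i}" "sum y {..<i} < sum x {..<Suc j}"
    unfolding sum.lessThan_Suc by blast+
qed

lemma coupling_chain:
  assumes "\<And>j. j \<le> n \<Longrightarrow> 0 \<le> x j" "\<And>i. i \<le> m \<Longrightarrow> 0 \<le> y i"
  shows "stair_chain {c \<in> {..n} \<times> {..m}. coupling x y c \<noteq> 0}"
  unfolding stair_chain_def
proof (intro allI impI, rule ccontr)
  fix j i j' i'
  assume a: "(j, i) \<in> {c \<in> {..n} \<times> {..m}. coupling x y c \<noteq> 0} \<and>
      (j', i') \<in> {c \<in> {..n} \<times> {..m}. coupling x y c \<noteq> 0} \<and> j < j'" "\<not> i \<le> i'"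
  then have *: "j \<le> n" "i \<le> m" "coupling x y (j, i) \<noteq> 0"
    "j' \<le> n" "i' \<le> m" "coupling x y (j', i') \<noteq> 0" "j < j'" "\<not> i \<le> i'"
    by simp_all
  have "sum x {..<j'} < sum y {..<Suc i'}" "sum y {..<i} < sum x {..<Suc j}"
    using coupling_positive_overlap(1)[OF assms(1) assms(2) *(6)]
      coupling_positive_overlap(2)[OF assms(1) assms(2) *(3)] * by simp_all
  moreover have "sum x {..<Suc j} \<le> sum x {..<j'}" "sum y {..<Suc i'} \<le> sum y {..<i}"
    using * assms by (auto intro!: sum_mono2 simp del: sum.lessThan_Suc)
  ultimately show False by linarith
qed

lemma coupling_commute: "coupling x y (j, i) = coupling y x (i, j)"
  by (simp add: coupling_def min.commute del: sum.lessThan_Suc)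

lemma coupling_row_sum:
  assumes nn: "\<And>j. j \<le> n \<Longrightarrow> 0 \<le> x j"
    and eq: "sum x {..n} = sum y {..m}" and j: "j \<le> n"
  shows "(\<Sum>i\<le>m. coupling x y (j, i)) = x j"
proof -
  \<comment> \<open>The sum over the row telescopes.\<close>
  define f where "f i = min (sum x {..<Suc j}) (sum y {..<i}) - min (sum x {..<j}) (sum y {..<i})"
    for i
  have "(\<Sum>i\<le>m. coupling x y (j, i)) = (\<Sum>i<Suc m. f (Suc i) - f i)"
    by (simp add: coupling_def f_def lessThan_Suc_atMost algebra_simps del: sum.lessThan_Suc)
  also have "\<dots> = f (Suc m) - f 0" by (rule sum_lessThan_telescope)
  also have "\<dots> = x j"
  proof -
    have "sum x {..<Suc j} \<le> sum y {..<Suc m}" "0 \<le> sum x {..<j}" "0 \<le> x j"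
      using nn j unfolding lessThan_Suc_atMost eq[symmetric]
      by (auto intro!: sum_mono2 sum_nonneg)
    then have "min (sum x {..<Suc j}) (sum y {..<Suc m}) = sum x {..<Suc j}"
      "min (sum x {..<j}) (sum y {..<Suc m}) = sum x {..<j}"
      "min (sum x {..<Suc j}) 0 = 0" "min (sum x {..<j}) 0 = 0"
      unfolding sum.lessThan_Suc by linarith+
    then show ?thesis unfolding f_def by simp
  qed
  finally show ?thesis .
qed

section \<open>Staircases\<close>

definition cells :: "nat \<Rightarrow> (nat \<Rightarrow> nat) \<times> (nat \<Rightarrow> nat) \<Rightarrow> (nat \<times> nat) set" where
  "cells n = (\<lambda>(b, e). {(j, i). j \<le> n \<and> b j \<le> i \<and> i \<le> e j})"

text \<open>The cells whose opposite facets are removed in the staircase tile: the upper ends of the vertical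
  steps, at which the staircase turns to the right.\<close>

definition corners :: "nat \<Rightarrow> (nat \<Rightarrow> nat) \<times> (nat \<Rightarrow> nat) \<Rightarrow> (nat \<times> nat) set" where
  "corners n = (\<lambda>(b, e). {(j, i). j < n \<and> i = e j \<and> b j \<noteq> e j})"

lemma staircaseD:
  assumes "(b, e) \<in> staircases n m"
  shows "j \<le> n \<Longrightarrow> b j \<le> e j" "j \<le> n \<Longrightarrow> e j \<le> m" "b 0 = 0" "e n = m" "j < n \<Longrightarrow> e j = b (Suc j)"
  using assms by (auto simp: staircases_def)

lemma staircase_b_mono:
  assumes "(b, e) \<in> staircases n m" "j \<le> j'" "j' \<le> n"
  shows "b j \<le> b j'"
  using assms(2,3)
proof (induction j' rule: dec_induct)
  case (step k)
  then have "b k \<le> e k" "e k = b (Suc k)" using staircaseD(1,5)[OF assms(1), of k] step.prems by linarith+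
  moreover have "b j \<le> b k" using step by simp
  ultimately show ?case by simp
qed simp

lemma staircase_step:
  assumes "(b, e) \<in> staircases n m" "j < j'" "j' \<le> n"
  shows "e j \<le> b j'"
proof -
  have "e j = b (Suc j)" using assms by (auto simp: staircases_def)
  then show ?thesis using staircase_b_mono[OF assms(1), of "Suc j" j'] assms by simp
qed

lemma cells_subset: "I \<in> staircases n m \<Longrightarrow> cells n I \<subseteq> {..n} \<times> {..m}"
  by (auto simp: staircases_def cells_def intro: order_trans)

lemma cells_chain:
  assumes "I \<in> staircases n m"
  shows "stair_chain (cells n I)"
proof -
  obtain b e where I: "I = (b, e)" by force
  show ?thesis
    unfolding stair_chain_def I cells_def
  proof clarsimp
    fix j i j' i' assume *: "i \<le> e j" "j' \<le> n" "b j' \<le> i'" "j < j'"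
    then have "e j \<le> b j'" using staircase_step[of b e n m j j'] assms I by blast
    with * show "i \<le> i'" by simp
  qed
qed

lemma corners_subset: "I \<in> staircases n m \<Longrightarrow> corners n I \<subseteq> cells n I"
  by (auto simp: staircases_def cells_def corners_def)

lemma card_cells:
  assumes "I \<in> staircases n m"
  shows "card (cells n I) = Suc (n + m)"
proof -
  obtain b e where I: "I = (b, e)" by force
  have "cells n I = Sigma {..n} (\<lambda>j. {b j..e j})" by (auto simp: I cells_def)
  then have "card (cells n I) = (\<Sum>j\<le>n. Suc (e j) - b j)" by simp
  moreover have "(\<Sum>j\<le>k. Suc (e j) - b j) = e k + Suc k" if "k \<le> n" for k
    using that
  proof (induction k)
    case 0
    then show ?case using assms by (simp add: I staircases_def)
  next
    case (Suc k)
    then have "e k = b (Suc k)" "b (Suc k) \<le> e (Suc k)" using assms by (auto simp: I staircases_def)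
    then show ?case using Suc by simp
  qed
  ultimately show ?thesis using assms by (simp add: I staircases_def)
qed

text \<open>The lowest starting height of column \<open>j\<close> of a staircase that contains \<open>C\<close>: everything in the
  earlier columns has to lie weakly below it.\<close>

definition chain_start :: "(nat \<times> nat) set \<Rightarrow> nat \<Rightarrow> nat" where
  "chain_start C j = Max (insert 0 {i. \<exists>j'<j. (j', i) \<in> C})"

definition chain_staircase :: "nat \<Rightarrow> nat \<Rightarrow> (nat \<times> nat) set \<Rightarrow> (nat \<Rightarrow> nat) \<times> (nat \<Rightarrow> nat)" where
  "chain_staircase n m C = (chain_start C, \<lambda>j. if j < n then chain_start C (Suc j) else m)"

context
  fixes n m :: nat and C :: "(nat \<times> nat) set"
  assumes C: "C \<subseteq> {..n} \<times> {..m}"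
begin

lemma finite_chain_rows: "finite {i. \<exists>j'<j. (j', i) \<in> C}"
  by (rule finite_subset[of _ "{..m}"]) (use C in auto)

lemma chain_start_ge: "(j', i) \<in> C \<Longrightarrow> j' < j \<Longrightarrow> i \<le> chain_start C j"
  unfolding chain_start_def by (rule Max_ge) (use finite_chain_rows in auto)

lemma chain_start_cases: "chain_start C j = 0 \<or> (\<exists>j'<j. (j', chain_start C j) \<in> C)"
  using Max_in[of "insert 0 {i. \<exists>j'<j. (j', i) \<in> C}"] finite_chain_rows
  unfolding chain_start_def by auto

lemma chain_start_le: "(\<And>j' i. (j', i) \<in> C \<Longrightarrow> j' < j \<Longrightarrow> i \<le> k) \<Longrightarrow> chain_start C j \<le> k"
  using chain_start_cases[of j] by force

lemma chain_start_mono: "j \<le> j' \<Longrightarrow> chain_start C j \<le> chain_start C j'"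
  by (meson chain_start_le chain_start_ge order_less_le_trans)

lemma chain_staircase: "chain_staircase n m C \<in> staircases n m"
proof -
  have "chain_start C j \<le> m" for j using C by (intro chain_start_le) auto
  moreover have "chain_start C 0 = 0" using chain_start_cases[of 0] by auto
  ultimately show ?thesis
    by (auto simp: staircases_def chain_staircase_def chain_start_mono)
qed

lemma chain_staircase_cells:
  assumes "stair_chain C"
  shows "C \<subseteq> cells n (chain_staircase n m C)"
proof clarify
  fix j i assume ji: "(j, i) \<in> C"
  moreover have "chain_start C j \<le> i"
    using ji assms by (intro chain_start_le) (auto simp: stair_chain_def)
  ultimately show "(j, i) \<in> cells n (chain_staircase n m C)"
    using C chain_start_ge[OF ji, of "Suc j"] by (auto simp: cells_def chain_staircase_def)
qed

lemma chain_staircase_corners: "corners n (chain_staircase n m C) \<subseteq> C"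
proof (clarsimp simp: corners_def chain_staircase_def)
  fix j assume j: "j < n" "chain_start C j \<noteq> chain_start C (Suc j)"
  then have less: "chain_start C j < chain_start C (Suc j)"
    using chain_start_mono[of j "Suc j"] by simp
  then obtain j' where j': "j' < Suc j" "(j', chain_start C (Suc j)) \<in> C"
    using chain_start_cases[of "Suc j"] by auto
  then have "\<not> j' < j" using chain_start_ge[of j' _ j] less by force
  then show "(j, chain_start C (Suc j)) \<in> C" using j' by (simp add: less_Suc_eq)
qed

text \<open>A staircase rises only at its corners. If these belong to \<open>C\<close>, every height that it reaches is
  attained by a cell of \<open>C\<close>, so it is the staircase built from \<open>C\<close> by \<open>chain_start\<close>.\<close>

lemma staircase_determined:
  assumes I: "(b, e) \<in> staircases n m" and "corners n (b, e) \<subseteq> C" "C \<subseteq> cells n (b, e)"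
  shows "j \<le> n \<Longrightarrow> b j = chain_start C j"
proof (induction j)
  case 0
  then show ?case using I chain_start_cases[of 0] by (auto simp: staircases_def)
next
  case (Suc j)
  then have j: "e j = b (Suc j)" "b j = chain_start C j" "j < n" using I by (auto simp: staircases_def)
  show ?case
  proof (rule antisym)
    show "b (Suc j) \<le> chain_start C (Suc j)"
    proof (cases "b j = e j")
      case True
      then show ?thesis using j chain_start_mono[of j "Suc j"] by simp
    next
      case False
      then have "(j, e j) \<in> C" using assms j by (auto simp: corners_def)
      then show ?thesis using chain_start_ge[of j "e j" "Suc j"] j by simp
    qed
    show "chain_start C (Suc j) \<le> b (Suc j)"
    proof (rule chain_start_le)
      fix j' i assume "(j', i) \<in> C" "j' < Suc j"
      then have "i \<le> e j'" "e j' \<le> b (Suc j)"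
        using assms(3) staircase_step[OF I, of j' "Suc j"] Suc.prems by (auto simp: cells_def)
      then show "i \<le> b (Suc j)" by simp
    qed
  qed
qed

end

lemma staircase_unique:
  assumes "I \<in> staircases n m" "corners n I \<subseteq> C" "C \<subseteq> cells n I"
    and "I' \<in> staircases n m" "corners n I' \<subseteq> C" "C \<subseteq> cells n I'"
  shows "cells n I = cells n I'" "corners n I = corners n I'"
proof -
  obtain b e b' e' where I: "I = (b, e)" "I' = (b', e')" by force
  have C: "C \<subseteq> {..n} \<times> {..m}" using assms cells_subset by blast
  have b: "b j = b' j" if "j \<le> n" for j
    using staircase_determined[OF C _ _ _ that] assms unfolding I by metis
  have e: "e j = e' j" if "j \<le> n" for j
  proof (cases "j = n")
    case True
    then show ?thesis using assms by (simp add: I staircases_def)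
  next
    case False
    then have "e j = b (Suc j)" "e' j = b' (Suc j)" using that assms by (auto simp: I staircases_def)
    then show ?thesis using b that False by simp
  qed
  show "cells n I = cells n I'" by (auto simp: I cells_def b e)
  show "corners n I = corners n I'" by (fastforce simp: I corners_def b e)
qed

text \<open>For a staircase with cells \<open>D\<close> and corners \<open>K\<close>: the cells whose opposite facets are missing in
  the intersection of the staircase tile with the product of two tiles deprived of the facets with
  labels \<open>J1\<close> and \<open>J2\<close>. A facet of a factor cuts out a facet of the staircase simplex only if its
  column or row is a single cell.\<close>

definition removed_cells :: "nat set \<Rightarrow> nat set \<Rightarrow> (nat \<times> nat) set \<Rightarrow> (nat \<times> nat) set
    \<Rightarrow> (nat \<times> nat) set" where
  "removed_cells J1 J2 D K = K
     \<union> {(j, i) \<in> D. j \<in> J1 \<and> (\<forall>i'. (j, i') \<in> D \<longrightarrow> i' = i)}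
     \<union> {(j, i) \<in> D. i \<in> J2 \<and> (\<forall>j'. (j', i) \<in> D \<longrightarrow> j' = j)}"

text \<open>Here \<open>C\<close> is the carrier of a point of the staircase tile. If a column or row has more than one
  cell, meeting it must follow from the remaining conditions. A column with several cells has a corner
  at its top, unless it is the last one; in that case row \<open>m\<close> consists only of the top cell of that
  column, and \<open>m \<in> J2\<close> forces \<open>C\<close> to contain this cell. A row with several cells starts at a corner,
  unless it is the bottom row; in that case column \<open>0\<close> is a single cell of that row, and \<open>0 \<in> J1\<close>
  forces \<open>C\<close> to contain it.\<close>

lemma removed_cells_subset_iff:
  assumes I: "I \<in> staircases n m" and C: "corners n I \<subseteq> C" "C \<subseteq> cells n I"
    and J: "J1 \<subseteq> {..n}" "J2 \<subseteq> {..m}" "n \<in> J1 \<longrightarrow> m \<in> J2" "0 \<in> J2 \<longrightarrow> 0 \<in> J1"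
  shows "removed_cells J1 J2 (cells n I) (corners n I) \<subseteq> C \<longleftrightarrow> J1 \<subseteq> fst ` C \<and> J2 \<subseteq> snd ` C"
proof
  assume J12: "J1 \<subseteq> fst ` C \<and> J2 \<subseteq> snd ` C"
  show "removed_cells J1 J2 (cells n I) (corners n I) \<subseteq> C"
  proof clarify
    fix j i assume "(j, i) \<in> removed_cells J1 J2 (cells n I) (corners n I)"
    then consider "(j, i) \<in> C" | "j \<in> J1" "\<And>i'. (j, i') \<in> cells n I \<Longrightarrow> i' = i"
      | "i \<in> J2" "\<And>j'. (j', i) \<in> cells n I \<Longrightarrow> j' = j"
      using C(1) unfolding removed_cells_def by auto
    then show "(j, i) \<in> C"
    proof cases
      case 2
      then obtain i' where "(j, i') \<in> C" using J12 by force
      with 2 C(2) show ?thesis by blast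
    next
      case 3
      then obtain j' where "(j', i) \<in> C" using J12 by force
      with 3 C(2) show ?thesis by blast
    qed
  qed
next
  assume R: "removed_cells J1 J2 (cells n I) (corners n I) \<subseteq> C"
  obtain b e where be: "I = (b, e)" by force
  note st = staircaseD[OF I[unfolded be]] and step = staircase_step[OF I[unfolded be]]
  have col: "(j, i) \<in> C" if "j \<in> J1" "(j, i) \<in> cells n I" "\<And>i'. (j, i') \<in> cells n I \<Longrightarrow> i' = i" for j i
    using R that unfolding removed_cells_def by blast
  have row: "(j, i) \<in> C" if "i \<in> J2" "(j, i) \<in> cells n I" "\<And>j'. (j', i) \<in> cells n I \<Longrightarrow> j' = j" for j i
    using R that unfolding removed_cells_def by blast
  have cells_iff: "(j, i) \<in> cells n I \<longleftrightarrow> j \<le> n \<and> b j \<le> i \<and> i \<le> e j" for j i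
    by (simp add: be cells_def)
  have corner: "(j, e j) \<in> C" if "j < n" "b j \<noteq> e j" for j
  proof -
    have "(j, e j) \<in> corners n I" using that unfolding be corners_def by simp
    then show ?thesis using C(1) by blast
  qed
  have "j \<in> fst ` C" if j: "j \<in> J1" for j
  proof -
    have jn: "j \<le> n" using j J(1) by auto
    have "\<exists>i. (j, i) \<in> C"
    proof (cases "b j = e j")
      case True
      have "(j, e j) \<in> C" by (rule col[OF j]) (use jn True in \<open>simp_all add: cells_iff\<close>)
      then show ?thesis ..
    next
      case ne: False
      show ?thesis
      proof (cases "j < n")
        case True
        then show ?thesis using corner ne by blast
      next
        case False
        then have "j = n" using jn by simp
        then have "m \<in> J2" "b n < m" using j J(3) ne st(1)[of n] st(4) by auto
        moreover have "j' = n" if j': "(j', m) \<in> cells n I" for j'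
        proof (rule ccontr)
          assume "j' \<noteq> n"
          then have "e j' \<le> b n" "m \<le> e j'" using step[of j' n] j' by (auto simp: cells_iff)
          then show False using \<open>b n < m\<close> by simp
        qed
        moreover have "(n, m) \<in> cells n I" using \<open>b n < m\<close> st(4) by (simp add: cells_iff)
        ultimately have "(n, m) \<in> C" by (intro row)
        then show ?thesis using \<open>j = n\<close> by blast
      qed
    qed
    then show ?thesis by force
  qed
  moreover have "i \<in> snd ` C" if i: "i \<in> J2" for i
  proof -
    have "i \<le> e n" using i J(2) st(4) by auto
    \<comment> \<open>The leftmost cell of row \<open>i\<close>.\<close>
    define j where "j = (LEAST j. i \<le> e j)"
    have j: "i \<le> e j" "j \<le> n" "\<And>j'. j' < j \<Longrightarrow> e j' < i"
      unfolding j_def using \<open>i \<le> e n\<close> by (auto intro: LeastI Least_le dest: not_less_Least)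
    have before: "e (j - 1) = b j" if "j > 0"
      using st(5)[of "j - 1"] that j(2) by simp
    have bi: "b j \<le> i"
    proof (cases "j = 0")
      case True
      then show ?thesis using st(3) by simp
    next
      case False
      then show ?thesis using before j(3)[of "j - 1"] by simp
    qed
    have cell: "(j, i) \<in> cells n I" using j bi by (simp add: cells_iff)
    have "\<exists>j'. (j', i) \<in> C"
    proof (cases "\<forall>j'. (j', i) \<in> cells n I \<longrightarrow> j' = j")
      case True
      then show ?thesis using row[OF i cell] by blast
    next
      case False
      then obtain j' where j': "(j', i) \<in> cells n I" "j' \<noteq> j" by blast
      then have "\<not> j' < j" using j(3)[of j'] by (auto simp: cells_iff)
      then have "j < j'" "j' \<le> n" "b j' \<le> i" using j' by (auto simp: cells_iff)
      then have ei: "e j = i" "j < n" using step[of j j'] j(1) by auto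
      show ?thesis
      proof (cases "b j = e j")
        case False
        then show ?thesis using corner[of j] ei by blast
      next
        case True
        then have "j = 0" using before j(3)[of "j - 1"] ei(1) by (cases "j = 0") auto
        then have "i = 0" "e 0 = 0" using True ei st(3) by auto
        moreover have "(0, 0) \<in> C"
          by (rule col) (use i J(4) \<open>i = 0\<close> \<open>e 0 = 0\<close> st(3) in \<open>simp_all add: cells_iff\<close>)
        ultimately show ?thesis by blast
      qed
    qed
    then show ?thesis by force
  qed
  ultimately show "J1 \<subseteq> fst ` C \<and> J2 \<subseteq> snd ` C" by blast
qed

section \<open>The triangulation of a product of two simplices\<close>

lemma convex_hull_image_iff:
  fixes f :: "'i \<Rightarrow> 'v::real_vector"
  assumes "finite S" "inj_on f S"
  shows "p \<in> convex hull (f ` S) \<longleftrightarrow>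
    (\<exists>u. (\<forall>s\<in>S. 0 \<le> u s) \<and> sum u S = 1 \<and> (\<Sum>s\<in>S. u s *\<^sub>R f s) = p)"
proof
  assume "p \<in> convex hull (f ` S)"
  then obtain u where u: "\<forall>x\<in>f ` S. 0 \<le> u x" "sum u (f ` S) = 1" "(\<Sum>x\<in>f ` S. u x *\<^sub>R x) = p"
    using assms by (auto simp: convex_hull_finite)
  then show "\<exists>u. (\<forall>s\<in>S. 0 \<le> u s) \<and> sum u S = 1 \<and> (\<Sum>s\<in>S. u s *\<^sub>R f s) = p"
    by (intro exI[of _ "u \<circ> f"]) (simp add: sum.reindex[OF assms(2)] o_def)
next
  assume "\<exists>u. (\<forall>s\<in>S. 0 \<le> u s) \<and> sum u S = 1 \<and> (\<Sum>s\<in>S. u s *\<^sub>R f s) = p"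
  then obtain u where u: "\<forall>s\<in>S. 0 \<le> u s" "sum u S = 1" and p: "(\<Sum>s\<in>S. u s *\<^sub>R f s) = p"
    by blast
  show "p \<in> convex hull (f ` S)"
    unfolding p[symmetric]
    by (rule convex_sum[OF assms(1) convex_convex_hull]) (use u in \<open>auto intro: hull_inc\<close>)
qed

lemma affine_coordinates_unique:
  fixes f :: "'i \<Rightarrow> 'v::real_vector"
  assumes "finite S" "inj_on f S" "\<not> affine_dependent (f ` S)"
    and "sum x S = sum y S" "(\<Sum>s\<in>S. x s *\<^sub>R f s) = (\<Sum>s\<in>S. y s *\<^sub>R f s)" "s \<in> S"
  shows "x s = y s"
proof (rule ccontr)
  assume ne: "x s \<noteq> y s"
  define U where "U p = x (inv_into S f p) - y (inv_into S f p)" for p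
  have U: "U (f s) = x s - y s" if "s \<in> S" for s
    using that assms(2) by (simp add: U_def)
  have "sum U (f ` S) = 0" "(\<Sum>p\<in>f ` S. U p *\<^sub>R p) = 0"
    using assms(4,5) by (simp_all add: sum.reindex[OF assms(2)] U sum_subtractf algebra_simps)
  moreover have "\<exists>p\<in>f ` S. U p \<noteq> 0" using assms(6) U ne by force
  ultimately show False
    using assms(1,3) affine_dependent_explicit_finite[of "f ` S"] by blast
qed

text \<open>Barycentric coordinates do not change when the simplex is replaced by a face containing the point.\<close>

lemma coordinates_supported:
  fixes f :: "'i \<Rightarrow> 'v::real_vector"
  assumes N: "finite N" "inj_on f N" "\<not> affine_dependent (f ` N)" and S: "S \<subseteq> N"
    and x: "sum x N = 1" "(\<Sum>j\<in>N. x j *\<^sub>R f j) \<in> convex hull (f ` S)" and j: "j \<in> N" "x j \<noteq> 0"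
  shows "j \<in> S"
proof -
  obtain u where u: "sum u S = 1" "(\<Sum>s\<in>S. u s *\<^sub>R f s) = (\<Sum>j\<in>N. x j *\<^sub>R f j)"
    using x(2) unfolding convex_hull_image_iff[OF finite_subset[OF S N(1)] inj_on_subset[OF N(2) S]]
    by blast
  define y where "y j = (if j \<in> S then u j else 0)" for j
  have "sum y N = sum u S" "(\<Sum>j\<in>N. y j *\<^sub>R f j) = (\<Sum>s\<in>S. u s *\<^sub>R f s)"
    using N(1) S by (intro sum.mono_neutral_cong_right; auto simp: y_def)+
  then have "x j = y j"
    using x(1) u j(1) by - (rule affine_coordinates_unique[OF N, of x y j], simp_all)
  then show ?thesis using j(2) by (simp add: y_def split: if_splits)
qed

locale simplex_pair =
  fixes n m :: nat and v :: "nat \<Rightarrow> 'a::euclidean_space" and w :: "nat \<Rightarrow> 'b::euclidean_space"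
  assumes inj_v: "inj_on v {..n}" and indep_v: "\<not> affine_dependent (v ` {..n})"
    and inj_w: "inj_on w {..m}" and indep_w: "\<not> affine_dependent (w ` {..m})"
begin

abbreviation grid :: "(nat \<times> nat) set" where "grid \<equiv> {..n} \<times> {..m}"

abbreviation vertex :: "nat \<times> nat \<Rightarrow> 'a \<times> 'b" where "vertex \<equiv> map_prod v w"

lemma inj_vertex: "inj_on vertex grid"
  using inj_v inj_w by (rule map_prod_inj_on)

lemma finite_subgrid: "D \<subseteq> grid \<Longrightarrow> finite D"
  by (rule finite_subset[of D grid]) simp_all

text \<open>The barycentric coordinates in the two factors are the marginals of the weights of the product
  vertices.\<close>

lemma combination_vertex:
  "(\<Sum>c\<in>grid. l c *\<^sub>R vertex c) =
     (\<Sum>j\<le>n. (\<Sum>i\<le>m. l (j, i)) *\<^sub>R v j, \<Sum>i\<le>m. (\<Sum>j\<le>n. l (j, i)) *\<^sub>R w i)"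
proof (rule prod_eqI)
  show "fst (\<Sum>c\<in>grid. l c *\<^sub>R vertex c) =
    fst (\<Sum>j\<le>n. (\<Sum>i\<le>m. l (j, i)) *\<^sub>R v j, \<Sum>i\<le>m. (\<Sum>j\<le>n. l (j, i)) *\<^sub>R w i)"
    by (simp add: fst_sum sum.cartesian_product' scaleR_left.sum)
  have "snd (\<Sum>c\<in>grid. l c *\<^sub>R vertex c) = (\<Sum>j\<le>n. \<Sum>i\<le>m. l (j, i) *\<^sub>R w i)"
    by (simp add: snd_sum sum.cartesian_product')
  also have "\<dots> = (\<Sum>i\<le>m. \<Sum>j\<le>n. l (j, i) *\<^sub>R w i)" by (rule sum.swap)
  finally show "snd (\<Sum>c\<in>grid. l c *\<^sub>R vertex c) =
    snd (\<Sum>j\<le>n. (\<Sum>i\<le>m. l (j, i)) *\<^sub>R v j, \<Sum>i\<le>m. (\<Sum>j\<le>n. l (j, i)) *\<^sub>R w i)"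
    by (simp add: scaleR_left.sum)
qed

lemma sum_grid: "sum l grid = (\<Sum>j\<le>n. \<Sum>i\<le>m. l (j, i))" "sum l grid = (\<Sum>i\<le>m. \<Sum>j\<le>n. l (j, i))"
  for l :: "nat \<times> nat \<Rightarrow> real"
  by (simp add: sum.cartesian_product') (simp add: sum.cartesian_product' sum.swap[of _ "{..n}"])

lemma chain_coordinates_unique:
  assumes "\<And>c. c \<in> grid \<Longrightarrow> 0 \<le> l c" "stair_chain {c \<in> grid. l c \<noteq> 0}"
    and "\<And>c. c \<in> grid \<Longrightarrow> 0 \<le> l' c" "stair_chain {c \<in> grid. l' c \<noteq> 0}"
    and "sum l grid = sum l' grid"
    and "(\<Sum>c\<in>grid. l c *\<^sub>R vertex c) = (\<Sum>c\<in>grid. l' c *\<^sub>R vertex c)" and "c \<in> grid"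
  shows "l c = l' c"
proof -
  obtain j i where c: "c = (j, i)" "j \<le> n" "i \<le> m" using assms(7) by force
  have x: "(\<Sum>i\<le>m. l (j, i)) = (\<Sum>i\<le>m. l' (j, i))" if "j \<le> n" for j
    by (rule affine_coordinates_unique[OF _ inj_v indep_v])
      (use assms(5,6) that in \<open>simp_all add: combination_vertex sum_grid(1)\<close>)
  have y: "(\<Sum>j\<le>n. l (j, i)) = (\<Sum>j\<le>n. l' (j, i))" if "i \<le> m" for i
    by (rule affine_coordinates_unique[OF _ inj_w indep_w])
      (use assms(5,6) that in \<open>simp_all add: combination_vertex sum_grid(2)\<close>)
  define x where "x j = (\<Sum>i\<le>m. l (j, i))" for j
  define y where "y i = (\<Sum>j\<le>n. l (j, i))" for i
  have "l (j, i) = coupling x y (j, i)"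
    by (rule coupling_unique[OF _ assms(2)]) (use c assms(1) in \<open>auto simp: x_def y_def\<close>)
  moreover have "l' (j, i) = coupling x y (j, i)"
    by (rule coupling_unique[OF _ assms(4)]) (use c assms(3) x y in \<open>auto simp: x_def y_def\<close>)
  ultimately show ?thesis by (simp add: c)
qed

text \<open>\<open>C\<close> is the support of the chain-supported coupling that represents \<open>z\<close>, that is, the vertex set of
  the chain simplex that has \<open>z\<close> in its relative interior.\<close>

definition carries :: "'a \<times> 'b \<Rightarrow> (nat \<times> nat) set \<Rightarrow> bool" where
  "carries z C \<longleftrightarrow> C \<subseteq> grid \<and> stair_chain C \<and>
     (\<exists>l. (\<forall>c\<in>C. 0 < l c) \<and> (\<forall>c. c \<notin> C \<longrightarrow> l c = 0) \<and> sum l grid = 1 \<and> (\<Sum>c\<in>grid. l c *\<^sub>R vertex c) = z)"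

lemma carries_grid: "carries z C \<Longrightarrow> C \<subseteq> grid" and carries_chain: "carries z C \<Longrightarrow> stair_chain C"
  by (auto simp: carries_def)

lemma carries_nonempty: "carries z C \<Longrightarrow> C \<noteq> {}"
  unfolding carries_def by (metis empty_iff sum.neutral zero_neq_one)

lemma carries_hull:
  assumes "carries z C"
  shows "z \<in> convex hull (vertex ` C)"
proof -
  obtain l where l: "\<forall>c\<in>C. 0 < l c" "\<forall>c. c \<notin> C \<longrightarrow> l c = 0" "sum l grid = 1"
    "(\<Sum>c\<in>grid. l c *\<^sub>R vertex c) = z" and C: "C \<subseteq> grid"
    using assms by (auto simp: carries_def)
  have "sum l C = sum l grid" "(\<Sum>c\<in>C. l c *\<^sub>R vertex c) = (\<Sum>c\<in>grid. l c *\<^sub>R vertex c)"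
    using l(2) by (auto intro!: sum.mono_neutral_left C simp: zero_prod_def)
  then have "(\<forall>c\<in>C. 0 \<le> l c) \<and> sum l C = 1 \<and> (\<Sum>c\<in>C. l c *\<^sub>R vertex c) = z"
    unfolding l(3,4) using l(1) less_imp_le by blast
  then show ?thesis
    unfolding convex_hull_image_iff[OF finite_subgrid[OF C] inj_on_subset[OF inj_vertex C]] by blast
qed

text \<open>Both \<open>C\<close> and \<open>D\<close> carry couplings of the barycentric coordinates of \<open>z\<close>, and there is only one
  coupling on chains.\<close>

lemma carries_in_hull_iff:
  assumes "carries z C" and D: "D \<subseteq> grid" "stair_chain D"
  shows "z \<in> convex hull (vertex ` D) \<longleftrightarrow> C \<subseteq> D"
proof
  assume "C \<subseteq> D"
  then show "z \<in> convex hull (vertex ` D)"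
    using carries_hull[OF assms(1)] hull_mono[OF image_mono[of C D vertex]] by blast
next
  assume "z \<in> convex hull (vertex ` D)"
  then obtain u where u: "\<forall>c\<in>D. 0 \<le> u c" "sum u D = 1" "(\<Sum>c\<in>D. u c *\<^sub>R vertex c) = z"
    unfolding convex_hull_image_iff[OF finite_subgrid[OF D(1)] inj_on_subset[OF inj_vertex D(1)]]
    by blast
  define l' where "l' c = (if c \<in> D then u c else 0)" for c
  have l': "sum l' grid = 1" "(\<Sum>c\<in>grid. l' c *\<^sub>R vertex c) = z"
  proof -
    have "sum l' grid = sum u D" "(\<Sum>c\<in>grid. l' c *\<^sub>R vertex c) = (\<Sum>c\<in>D. u c *\<^sub>R vertex c)"
      using D(1) by (intro sum.mono_neutral_cong_right; auto simp: l'_def)+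
    then show "sum l' grid = 1" "(\<Sum>c\<in>grid. l' c *\<^sub>R vertex c) = z" using u by simp_all
  qed
  obtain l where l: "\<forall>c\<in>C. 0 < l c" "\<forall>c. c \<notin> C \<longrightarrow> l c = 0" "sum l grid = 1"
    "(\<Sum>c\<in>grid. l c *\<^sub>R vertex c) = z" and C: "C \<subseteq> grid" "stair_chain C"
    using assms(1) by (auto simp: carries_def)
  show "C \<subseteq> D"
  proof
    fix c assume c: "c \<in> C"
    have "l c = l' c"
    proof (rule chain_coordinates_unique)
      show "0 \<le> l c" for c using l(1,2) by (metis order.refl less_imp_le)
      show "stair_chain {c \<in> grid. l c \<noteq> 0}" by (rule stair_chain_subset[OF C(2)]) (use l(2) in auto)
      show "0 \<le> l' c" if "c \<in> grid" for c using u(1) by (auto simp: l'_def)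
      show "stair_chain {c \<in> grid. l' c \<noteq> 0}"
        by (rule stair_chain_subset[OF D(2)]) (auto simp: l'_def split: if_splits)
    qed (use l l' c C in auto)
    then show "c \<in> D" using l(1) c by (force simp: l'_def split: if_splits)
  qed
qed

lemma carries_fst_iff:
  assumes "carries z C" and S: "S \<subseteq> {..n}"
  shows "fst z \<in> convex hull (v ` S) \<longleftrightarrow> fst ` C \<subseteq> S"
proof
  assume "fst ` C \<subseteq> S"
  have "fst z \<in> fst ` (convex hull (vertex ` C))"
    using carries_hull[OF assms(1)] by simp
  also have "\<dots> = convex hull (v ` fst ` C)"
    by (simp add: convex_hull_linear_image linear_fst image_image)
  also have "\<dots> \<subseteq> convex hull (v ` S)"
    by (intro hull_mono image_mono) fact
  finally show "fst z \<in> convex hull (v ` S)" .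
next
  assume hull: "fst z \<in> convex hull (v ` S)"
  obtain l where l: "\<forall>c\<in>C. 0 < l c" "\<forall>c. c \<notin> C \<longrightarrow> l c = 0" "sum l grid = 1"
    "(\<Sum>c\<in>grid. l c *\<^sub>R vertex c) = z" and C: "C \<subseteq> grid"
    using assms(1) by (auto simp: carries_def)
  have nn: "0 \<le> l c" for c using l(1,2) by (metis order.refl less_imp_le)
  show "fst ` C \<subseteq> S"
  proof clarsimp
    fix j i assume ji: "(j, i) \<in> C"
    have "l (j, i) \<le> (\<Sum>i\<le>m. l (j, i))"
      using ji C nn by (intro member_le_sum[where f="\<lambda>i. l (j, i)"]) auto
    then have "(\<Sum>i\<le>m. l (j, i)) \<noteq> 0" using l(1) ji by force
    then show "j \<in> S"
      by (intro coordinates_supported[OF _ inj_v indep_v S, where x="\<lambda>j. (\<Sum>i\<le>m. l (j, i))"])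
        (use l hull C ji in \<open>auto simp: combination_vertex simp flip: sum_grid(1)\<close>)
  qed
qed

lemma carries_snd_iff:
  assumes "carries z C" and S: "S \<subseteq> {..m}"
  shows "snd z \<in> convex hull (w ` S) \<longleftrightarrow> snd ` C \<subseteq> S"
proof
  assume "snd ` C \<subseteq> S"
  have "snd z \<in> snd ` (convex hull (vertex ` C))"
    using carries_hull[OF assms(1)] by simp
  also have "\<dots> = convex hull (w ` snd ` C)"
    by (simp add: convex_hull_linear_image linear_snd image_image)
  also have "\<dots> \<subseteq> convex hull (w ` S)"
    by (intro hull_mono image_mono) fact
  finally show "snd z \<in> convex hull (w ` S)" .
next
  assume hull: "snd z \<in> convex hull (w ` S)"
  obtain l where l: "\<forall>c\<in>C. 0 < l c" "\<forall>c. c \<notin> C \<longrightarrow> l c = 0" "sum l grid = 1"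
    "(\<Sum>c\<in>grid. l c *\<^sub>R vertex c) = z" and C: "C \<subseteq> grid"
    using assms(1) by (auto simp: carries_def)
  have nn: "0 \<le> l c" for c using l(1,2) by (metis order.refl less_imp_le)
  show "snd ` C \<subseteq> S"
  proof clarsimp
    fix j i assume ji: "(j, i) \<in> C"
    have "l (j, i) \<le> (\<Sum>j\<le>n. l (j, i))"
      using ji C nn by (intro member_le_sum[where f="\<lambda>j. l (j, i)"]) auto
    then have "(\<Sum>j\<le>n. l (j, i)) \<noteq> 0" using l(1) ji by force
    then show "i \<in> S"
      by (intro coordinates_supported[OF _ inj_w indep_w S, where x="\<lambda>i. (\<Sum>j\<le>n. l (j, i))"])
        (use l hull C ji in \<open>auto simp: combination_vertex simp flip: sum_grid(2)\<close>)
  qed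
qed

lemma carrier_exists:
  assumes "x \<in> convex hull (v ` {..n})" "y \<in> convex hull (w ` {..m})"
  shows "\<exists>C. carries (x, y) C"
proof -
  obtain a where a: "\<And>j. j \<le> n \<Longrightarrow> 0 \<le> a j" "sum a {..n} = 1" "(\<Sum>j\<le>n. a j *\<^sub>R v j) = x"
    using assms(1) by (auto simp: convex_hull_image_iff inj_v)
  obtain b where b: "\<And>i. i \<le> m \<Longrightarrow> 0 \<le> b i" "sum b {..m} = 1" "(\<Sum>i\<le>m. b i *\<^sub>R w i) = y"
    using assms(2) by (auto simp: convex_hull_image_iff inj_w)
  define C where "C = {c \<in> grid. coupling a b c \<noteq> 0}"
  define l where "l c = (if c \<in> C then coupling a b c else 0)" for c
  have l: "l c = coupling a b c" if "c \<in> grid" for c using that by (simp add: l_def C_def)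
  have rows: "(\<Sum>i\<le>m. l (j, i)) = a j" if "j \<le> n" for j
    using coupling_row_sum[of n a b m j] a b that by (simp add: l)
  have cols: "(\<Sum>j\<le>n. l (j, i)) = b i" if "i \<le> m" for i
    using coupling_row_sum[of m b a n i] a b that by (simp add: l coupling_commute[of b a])
  have "stair_chain C" unfolding C_def by (rule coupling_chain) (use a b in auto)
  moreover have "\<forall>c\<in>C. 0 < l c"
    using coupling_nonneg[of a _ b] a(1) b(1) by (force simp: l_def C_def less_le)
  moreover have "sum l grid = 1" using a(2) by (simp add: sum_grid(1) rows)
  moreover have "(\<Sum>c\<in>grid. l c *\<^sub>R vertex c) = (x, y)"
    using a(3) b(3) by (simp add: combination_vertex rows cols)
  moreover have "C \<subseteq> grid" "\<forall>c. c \<notin> C \<longrightarrow> l c = 0" by (auto simp: C_def l_def)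
  ultimately have "carries (x, y) C"
    unfolding carries_def by blast
  then show ?thesis ..
qed

lemma carries_in_product:
  assumes "carries z C"
  shows "z \<in> (convex hull (v ` {..n})) \<times> (convex hull (w ` {..m}))"
  using carries_fst_iff[OF assms, of "{..n}"] carries_snd_iff[OF assms, of "{..m}"]
    carries_grid[OF assms] by (cases z) force

lemma hull_subset_product:
  assumes "D \<subseteq> grid"
  shows "convex hull (vertex ` D) \<subseteq> (convex hull (v ` {..n})) \<times> (convex hull (w ` {..m}))"
  unfolding convex_hull_Times[symmetric] by (rule hull_mono) (use assms in auto)

text \<open>If the vertices were affinely dependent, Radon's theorem would give a point in the hulls of two
  disjoint subchains; its nonempty carrier would be contained in both.\<close>

lemma chain_independent:
  assumes "D \<subseteq> grid" "stair_chain D"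
  shows "\<not> affine_dependent (vertex ` D)"
proof
  assume "affine_dependent (vertex ` D)"
  moreover have "finite (vertex ` D)" using finite_subgrid[OF assms(1)] by simp
  ultimately obtain M P where MP: "M \<inter> P = {}" "M \<union> P = vertex ` D"
      "convex hull M \<inter> convex hull P \<noteq> {}"
    using Radon_partition by metis
  then obtain z where z: "z \<in> convex hull M" "z \<in> convex hull P" by blast
  obtain D1 D2 where D: "M = vertex ` D1" "D1 \<subseteq> D" "P = vertex ` D2" "D2 \<subseteq> D"
    using MP(2) by (metis Un_upper1 Un_upper2 subset_image_iff)
  have "z \<in> (convex hull (v ` {..n})) \<times> (convex hull (w ` {..m}))"
    using hull_subset_product[of D1] z(1) D assms(1) by auto
  then obtain C where C: "carries z C" using carrier_exists by (cases z) auto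
  have "C \<subseteq> D1" "C \<subseteq> D2"
    using carries_in_hull_iff[OF C, of D1] carries_in_hull_iff[OF C, of D2] z D assms
      stair_chain_subset[OF assms(2)] by simp_all
  then show False using MP(1) D(1,3) carries_nonempty[OF C] by blast
qed

end

section \<open>Simplices and their vertices\<close>

lemma verts_convex_hull: "\<not> affine_dependent B \<Longrightarrow> verts (convex hull B) = B"
  for B :: "'a::euclidean_space set"
  by (simp add: verts_def extreme_point_of_convex_hull_affine_independent)

lemma simplex_verts:
  assumes "int n simplex \<sigma>"
  shows "\<not> affine_dependent (verts \<sigma>)" "\<sigma> = convex hull (verts \<sigma>)" "finite (verts \<sigma>)"
    "card (verts \<sigma>) = Suc n"
  using assms by (auto simp: simplex verts_convex_hull)

lemma opposite_facet_convex_hull: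
  "\<not> affine_dependent B \<Longrightarrow> opposite_facet (convex hull B) p = convex hull (B - {p})"
  for B :: "'a::euclidean_space set"
  by (simp add: opposite_facet_def verts_convex_hull)

lemma face_of_independent_hull_iff:
  fixes B :: "'a::euclidean_space set"
  assumes "\<not> affine_dependent B"
  shows "F face_of convex hull B \<longleftrightarrow> (\<exists>C\<subseteq>B. F = convex hull C)"
  using face_of_convex_hull_affine_independent[OF assms] by auto

lemma aff_dim_independent_hull:
  fixes B :: "'a::euclidean_space set"
  assumes "\<not> affine_dependent B"
  shows "aff_dim (convex hull B) = int (card B) - 1"
  by (simp add: aff_dim_convex_hull aff_dim_affine_independent assms)

lemma simplex_facet_iff:
  fixes B :: "'a::euclidean_space set"
  assumes B: "\<not> affine_dependent B"
  shows "simplex_facet F (convex hull B) \<longleftrightarrow> (\<exists>p\<in>B. F = convex hull (B - {p}))"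
proof
  have fin: "finite B" using B by (rule aff_independent_finite)
  { assume "simplex_facet F (convex hull B)"
    then obtain C where C: "C \<subseteq> B" "F = convex hull C" "aff_dim F = aff_dim (convex hull B) - 1"
      unfolding simplex_facet_def face_of_independent_hull_iff[OF B] by blast
    then have "int (card C) + 1 = int (card B)"
      using aff_dim_independent_hull[OF B] aff_dim_independent_hull[OF affine_independent_subset[OF B C(1)]]
      by simp
    then have "card (B - C) = 1" using C(1) fin by (simp add: card_Diff_subset finite_subset)
    then obtain p where "B - C = {p}" using card_1_singletonE by blast
    then have "p \<in> B" "C = B - {p}" using C(1) by blast+
    with C(2) show "\<exists>p\<in>B. F = convex hull (B - {p})" by blast }
  { assume "\<exists>p\<in>B. F = convex hull (B - {p})"
    then obtain p where p: "p \<in> B" "F = convex hull (B - {p})" by blast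
    have "int (card (B - {p})) = int (card B) - 1"
      using p(1) fin card_gt_0_iff[of B] by (auto simp: of_nat_diff)
    then show "simplex_facet F (convex hull B)"
      unfolding simplex_facet_def face_of_independent_hull_iff[OF B] p(2)
      using aff_dim_independent_hull[OF B]
        aff_dim_independent_hull[OF affine_independent_subset[OF B Diff_subset], of "{p}"] by auto }
qed

text \<open>Describes a tile by the facets opposite to enumerated vertices. It is stated for an arbitrary
  enumeration because it is needed for the increasing and for the decreasing one.\<close>

lemma points_by_vertices:
  assumes t: "basic_tile n k t" and v: "bij_betw v {..n} (verts (underlying t))"
  shows "points t = {x \<in> convex hull (v ` {..n}).
    \<forall>j\<in>{j \<in> {..n}. opposite_facet (underlying t) (v j) \<in> removed t}. x \<notin> convex hull (v ` ({..n} - {j}))}"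
proof -
  let ?s = "underlying t"
  have s: "int n simplex ?s" and R: "\<forall>F\<in>removed t. simplex_facet F ?s"
    using t by (auto simp: basic_tile_def)
  have inj: "inj_on v {..n}" and im: "v ` {..n} = verts ?s" using v by (auto simp: bij_betw_def)
  have hull: "?s = convex hull (v ` {..n})" and ind: "\<not> affine_dependent (v ` {..n})"
    using simplex_verts[OF s] im by simp_all
  have opp: "opposite_facet ?s (v j) = convex hull (v ` ({..n} - {j}))" if "j \<le> n" for j
  proof -
    have "v ` {..n} - {v j} = v ` ({..n} - {j})" using inj that by (auto dest: inj_onD)
    then show ?thesis by (simp add: hull opposite_facet_convex_hull[OF ind])
  qed
  have "\<exists>j\<le>n. F = opposite_facet ?s (v j)" if "F \<in> removed t" for F
  proof -
    have "simplex_facet F (convex hull (v ` {..n}))" using R that hull by simp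
    then obtain j where "j \<le> n" "F = convex hull (v ` {..n} - {v j})"
      unfolding simplex_facet_iff[OF ind] by blast
    then show ?thesis by (metis hull opposite_facet_convex_hull[OF ind])
  qed
  then have "x \<in> points t \<longleftrightarrow> x \<in> ?s \<and>
      (\<forall>j\<le>n. opposite_facet ?s (v j) \<in> removed t \<longrightarrow> x \<notin> opposite_facet ?s (v j))" for x
    unfolding points_def Diff_iff by blast
  then show ?thesis by (auto simp: set_eq_iff opp simp flip: hull)
qed

section \<open>The product of two tiles\<close>

context simplex_pair
begin

lemma stair_simplex_hull: "stair_simplex n v w I = convex hull (vertex ` cells n I)"
proof -
  obtain b e where I: "I = (b, e)" by force
  have "{(v j, w i) | j i. j \<le> n \<and> i \<in> {b j..e j}} = vertex ` cells n I"
    by (force simp: I cells_def)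
  then show ?thesis by (simp add: stair_simplex_def I)
qed

lemma opposite_facet_chain:
  assumes D: "D \<subseteq> grid" "stair_chain D" and "r \<in> D"
  shows "opposite_facet (convex hull (vertex ` D)) (vertex r) = convex hull (vertex ` (D - {r}))"
proof -
  have "vertex ` D - {vertex r} = vertex ` (D - {r})"
    by (subst inj_on_image_set_diff[OF inj_vertex]) (use assms in auto)
  then show ?thesis by (simp add: opposite_facet_convex_hull[OF chain_independent[OF D]])
qed

text \<open>A point of a chain simplex lies in the facet opposite to \<open>r\<close> iff its carrier misses \<open>r\<close>.\<close>

lemma deprived_simplex_iff:
  assumes C: "carries z C" and D: "D \<subseteq> grid" "stair_chain D" and R: "R \<subseteq> D"
  shows "z \<in> convex hull (vertex ` D) - (\<Union>r\<in>R. opposite_facet (convex hull (vertex ` D)) (vertex r))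
    \<longleftrightarrow> C \<subseteq> D \<and> R \<subseteq> C"
proof -
  have "z \<in> opposite_facet (convex hull (vertex ` D)) (vertex r) \<longleftrightarrow> C \<subseteq> D - {r}" if "r \<in> R" for r
  proof -
    have "D - {r} \<subseteq> grid" "stair_chain (D - {r})" using D stair_chain_subset by blast+
    moreover have "r \<in> D" using R that by blast
    ultimately show ?thesis using carries_in_hull_iff[OF C] opposite_facet_chain[OF D] by simp
  qed
  then show ?thesis using carries_in_hull_iff[OF C D] by auto
qed

lemma stair_tile_iff:
  assumes "I \<in> staircases n m" "carries z C"
  shows "z \<in> stair_tile n v w I \<longleftrightarrow> C \<subseteq> cells n I \<and> corners n I \<subseteq> C"
proof -
  obtain b e where I: "I = (b, e)" by force
  have "stair_tile n v w I = convex hull (vertex ` cells n I) -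
      (\<Union>r\<in>corners n I. opposite_facet (convex hull (vertex ` cells n I)) (vertex r))"
    unfolding stair_tile_def I prod.case stair_simplex_hull corners_def by auto
  then show ?thesis
    using deprived_simplex_iff[OF assms(2) cells_subset[OF assms(1)] cells_chain[OF assms(1)]
        corners_subset[OF assms(1)]] by simp
qed

definition cell_tile ::
  "nat set \<Rightarrow> nat set \<Rightarrow> (nat \<Rightarrow> nat) \<times> (nat \<Rightarrow> nat) \<Rightarrow> ('a \<times> 'b) tile" where
  "cell_tile J1 J2 I = Tile (convex hull (vertex ` cells n I))
     ((\<lambda>c. opposite_facet (convex hull (vertex ` cells n I)) (vertex c)) `
        removed_cells J1 J2 (cells n I) (corners n I))"

lemma underlying_cell_tile: "underlying (cell_tile J1 J2 I) = stair_simplex n v w I"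
  by (simp add: cell_tile_def stair_simplex_hull)

lemma removed_cells_subset:
  assumes "I \<in> staircases n m"
  shows "removed_cells J1 J2 (cells n I) (corners n I) \<subseteq> cells n I"
  using corners_subset[OF assms] by (auto simp: removed_cells_def)

lemma points_cell_tile_iff:
  assumes I: "I \<in> staircases n m" and "carries z C"
  shows "z \<in> points (cell_tile J1 J2 I) \<longleftrightarrow>
    C \<subseteq> cells n I \<and> removed_cells J1 J2 (cells n I) (corners n I) \<subseteq> C"
  using deprived_simplex_iff[OF assms(2) cells_subset[OF I] cells_chain[OF I] removed_cells_subset[OF I]]
  by (simp add: points_def cell_tile_def)

lemma cell_tile_basic:
  assumes I: "I \<in> staircases n m"
  shows "\<exists>k. basic_tile (n + m) k (cell_tile J1 J2 I)"
proof -
  have ind: "\<not> affine_dependent (vertex ` cells n I)"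
    by (rule chain_independent[OF cells_subset[OF I] cells_chain[OF I]])
  have "card (vertex ` cells n I) = Suc (n + m)"
    using card_image[OF inj_on_subset[OF inj_vertex cells_subset[OF I]]] card_cells[OF I] by simp
  then have "int (n + m) simplex convex hull (vertex ` cells n I)"
    using ind by (intro simplex_convex_hull) simp
  moreover have "simplex_facet (opposite_facet (convex hull (vertex ` cells n I)) (vertex c))
      (convex hull (vertex ` cells n I))" if "c \<in> cells n I" for c
    using that unfolding opposite_facet_convex_hull[OF ind] simplex_facet_iff[OF ind] by blast
  ultimately show ?thesis
    using removed_cells_subset[OF I] by (force simp: basic_tile_def cell_tile_def)
qed

context
  fixes J1 J2 :: "nat set" and P :: "'a set" and Q :: "'b set"
  assumes J1: "J1 \<subseteq> {..n}" and J2: "J2 \<subseteq> {..m}"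
    and P: "P = {x \<in> convex hull (v ` {..n}). \<forall>j\<in>J1. x \<notin> convex hull (v ` ({..n} - {j}))}"
    and Q: "Q = {y \<in> convex hull (w ` {..m}). \<forall>i\<in>J2. y \<notin> convex hull (w ` ({..m} - {i}))}"
    and last: "n \<in> J1 \<longrightarrow> m \<in> J2" and first: "0 \<in> J2 \<longrightarrow> 0 \<in> J1"
begin

lemma product_iff:
  assumes "carries z C"
  shows "z \<in> P \<times> Q \<longleftrightarrow> J1 \<subseteq> fst ` C \<and> J2 \<subseteq> snd ` C"
proof -
  have "z \<in> P \<times> Q \<longleftrightarrow> (\<forall>j\<in>J1. fst z \<notin> convex hull (v ` ({..n} - {j}))) \<and>
      (\<forall>i\<in>J2. snd z \<notin> convex hull (w ` ({..m} - {i})))"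
    using carries_in_product[OF assms] by (auto simp: P Q mem_Times_iff)
  also have "\<dots> \<longleftrightarrow> (\<forall>j\<in>J1. \<not> fst ` C \<subseteq> {..n} - {j}) \<and> (\<forall>i\<in>J2. \<not> snd ` C \<subseteq> {..m} - {i})"
    using carries_fst_iff[OF assms Diff_subset] carries_snd_iff[OF assms Diff_subset] by simp
  also have "\<dots> \<longleftrightarrow> J1 \<subseteq> fst ` C \<and> J2 \<subseteq> snd ` C"
  proof -
    have "fst ` C \<subseteq> {..n}" "snd ` C \<subseteq> {..m}" using carries_grid[OF assms] by auto
    then show ?thesis by blast
  qed
  finally show ?thesis .
qed

lemma carrier_in_product: "z \<in> P \<times> Q \<Longrightarrow> \<exists>C. carries z C"
  using carrier_exists by (cases z) (auto simp: P Q)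

text \<open>Translated to the carrier of a point, the two sides are the two sides of
  \<open>removed_cells_subset_iff\<close>.\<close>

lemma points_cell_tile:
  assumes I: "I \<in> staircases n m"
  shows "points (cell_tile J1 J2 I) = stair_tile n v w I \<inter> (P \<times> Q)"
proof -
  have *: "z \<in> points (cell_tile J1 J2 I) \<longleftrightarrow> z \<in> stair_tile n v w I \<inter> (P \<times> Q)"
    if C: "carries z C" for z C
  proof -
    have "corners n I \<subseteq> removed_cells J1 J2 (cells n I) (corners n I)"
      by (auto simp: removed_cells_def)
    then show ?thesis
      using points_cell_tile_iff[OF I C] stair_tile_iff[OF I C] product_iff[OF C]
        removed_cells_subset_iff[OF I _ _ J1 J2 last first, of C] by auto
  qed
  show ?thesis
  proof (intro set_eqI iffI)
    fix z assume z: "z \<in> points (cell_tile J1 J2 I)"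
    then have "z \<in> convex hull (vertex ` cells n I)" by (simp add: points_def cell_tile_def)
    then have "z \<in> (convex hull (v ` {..n})) \<times> (convex hull (w ` {..m}))"
      using hull_subset_product[OF cells_subset[OF I]] by blast
    then obtain C where "carries z C" using carrier_exists by (cases z) auto
    then show "z \<in> stair_tile n v w I \<inter> (P \<times> Q)" using * z by blast
  next
    fix z assume z: "z \<in> stair_tile n v w I \<inter> (P \<times> Q)"
    then obtain C where "carries z C" using carrier_in_product by blast
    then show "z \<in> points (cell_tile J1 J2 I)" using * z by blast
  qed
qed

text \<open>Staircases that agree on the columns up to \<open>n\<close> give the same tile, and the carrier of a common point
  determines them there.\<close>

lemma cell_tiles_disjoint:
  assumes I: "I \<in> staircases n m" and I': "I' \<in> staircases n m"
    and z: "z \<in> points (cell_tile J1 J2 I)" "z \<in> points (cell_tile J1 J2 I')"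
  shows "cell_tile J1 J2 I = cell_tile J1 J2 I'"
proof -
  have zt: "z \<in> P \<times> Q" "z \<in> stair_tile n v w I" "z \<in> stair_tile n v w I'"
    using z points_cell_tile[OF I] points_cell_tile[OF I'] by auto
  then obtain C where C: "carries z C" using carrier_in_product by blast
  have "cells n I = cells n I'" "corners n I = corners n I'"
    using staircase_unique[OF I _ _ I', of C] zt(2,3) stair_tile_iff[OF I C] stair_tile_iff[OF I' C]
    by blast+
  then show ?thesis by (simp add: cell_tile_def)
qed

lemma cell_tiles_cover: "(\<Union>I\<in>staircases n m. points (cell_tile J1 J2 I)) = P \<times> Q"
proof
  show "(\<Union>I\<in>staircases n m. points (cell_tile J1 J2 I)) \<subseteq> P \<times> Q"
    using points_cell_tile by auto
  show "P \<times> Q \<subseteq> (\<Union>I\<in>staircases n m. points (cell_tile J1 J2 I))"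
  proof
    fix z assume z: "z \<in> P \<times> Q"
    then obtain C where C: "carries z C" using carrier_in_product by blast
    let ?I = "chain_staircase n m C"
    have I: "?I \<in> staircases n m" by (rule chain_staircase[OF carries_grid[OF C]])
    have "z \<in> stair_tile n v w ?I"
      using stair_tile_iff[OF I C] chain_staircase_corners[OF carries_grid[OF C]]
        chain_staircase_cells[OF carries_grid[OF C] carries_chain[OF C]] by blast
    then show "z \<in> (\<Union>I\<in>staircases n m. points (cell_tile J1 J2 I))"
      using z I points_cell_tile by auto
  qed
qed

end

end

text \<open>What has to be known about the pieces of a single product of two tiles in order to assemble the
  product tiling: \<open>\<T>\<close> turns the collection \<open>\<P>\<close> of point sets into pairwise disjoint basic tiles of
  dimension \<open>d\<close> that fill \<open>X\<close>.\<close>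

definition tiles_product ::
  "('a::euclidean_space \<times> 'b::euclidean_space) set set \<Rightarrow> ('a \<times> 'b) set \<Rightarrow> nat \<Rightarrow>
    ('a \<times> 'b) set set \<Rightarrow> ('a \<times> 'b) tile set \<Rightarrow> bool" where
  "tiles_product K X d \<P> \<T> \<longleftrightarrow> points ` \<T> = \<P> \<and>
     (\<forall>t\<in>\<T>. underlying t \<in> K \<and> (\<exists>k. basic_tile d k t)) \<and>
     pairwise (\<lambda>t t'. disjnt (points t) (points t')) \<T> \<and> \<Union> \<P> = X"

lemma (in simplex_pair) stair_tiles_tile_product:
  assumes "J1 \<subseteq> {..n}" "J2 \<subseteq> {..m}"
    and "P = {x \<in> convex hull (v ` {..n}). \<forall>j\<in>J1. x \<notin> convex hull (v ` ({..n} - {j}))}"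
    and "Q = {y \<in> convex hull (w ` {..m}). \<forall>i\<in>J2. y \<notin> convex hull (w ` ({..m} - {i}))}"
    and "n \<in> J1 \<longrightarrow> m \<in> J2" "0 \<in> J2 \<longrightarrow> 0 \<in> J1"
    and K: "\<And>I. I \<in> staircases n m \<Longrightarrow> stair_simplex n v w I \<in> K"
  shows "\<exists>\<T>. tiles_product K (P \<times> Q) (n + m)
    ((\<lambda>I. stair_tile n v w I \<inter> (P \<times> Q)) ` staircases n m) \<T>"
proof (intro exI[of _ "cell_tile J1 J2 ` staircases n m"])
  note a = assms(1-6)
  have "points ` cell_tile J1 J2 ` staircases n m = (\<lambda>I. stair_tile n v w I \<inter> (P \<times> Q)) ` staircases n m"
    unfolding image_image using points_cell_tile[OF a] by simp
  moreover from this have "\<Union> ((\<lambda>I. stair_tile n v w I \<inter> (P \<times> Q)) ` staircases n m) = P \<times> Q"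
    using cell_tiles_cover[OF a] by (simp add: image_image)
  moreover have "pairwise (\<lambda>t t'. disjnt (points t) (points t')) (cell_tile J1 J2 ` staircases n m)"
    unfolding pairwise_def disjnt_def using cell_tiles_disjoint[OF a] by blast
  ultimately show "tiles_product K (P \<times> Q) (n + m)
    ((\<lambda>I. stair_tile n v w I \<inter> (P \<times> Q)) ` staircases n m) (cell_tile J1 J2 ` staircases n m)"
    using K cell_tile_basic unfolding tiles_product_def by (auto simp: underlying_cell_tile)
qed

text \<open>Rotating a staircase by a half turn gives a staircase, so the reversed tiles have their underlying
  simplices in the same triangulation.\<close>

lemma reversed_stair_simplex:
  assumes "I \<in> staircases n m"
  shows "stair_simplex n (\<lambda>j. v (n - j)) (\<lambda>i. w (m - i)) I \<in> stair_simplex n v w ` staircases n m"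
proof -
  obtain b e where I: "I = (b, e)" by force
  note st = staircaseD[OF assms[unfolded I]]
  let ?I = "(\<lambda>j. m - e (n - j), \<lambda>j. m - b (n - j))"
  have "?I \<in> staircases n m"
  proof -
    have "m - b (n - j) = m - e (n - Suc j)" if "j < n" for j
      using st(5)[of "n - Suc j"] that by (simp add: Suc_diff_Suc)
    then show ?thesis using st(1-4) by (auto simp: staircases_def diff_le_mono2)
  qed
  moreover have "{(v (n - j), w (m - i)) |j i. j \<le> n \<and> i \<in> {b j..e j}} =
     {(v j, w i) |j i. j \<le> n \<and> i \<in> {m - e (n - j)..m - b (n - j)}}" (is "?A = ?B")
  proof
    show "?A \<subseteq> ?B"
    proof
      fix p assume "p \<in> ?A"
      then obtain j i where ji: "p = (v (n - j), w (m - i))" "j \<le> n" "b j \<le> i" "i \<le> e j" by auto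
      then have "p = (v (n - j), w (m - i)) \<and> n - j \<le> n \<and>
          m - i \<in> {m - e (n - (n - j))..m - b (n - (n - j))}" by auto
      then show "p \<in> ?B" by blast
    qed
    show "?B \<subseteq> ?A"
    proof
      fix p assume "p \<in> ?B"
      then obtain j i where ji: "p = (v j, w i)" "j \<le> n" "m - e (n - j) \<le> i" "i \<le> m - b (n - j)"
        by auto
      moreover have "b (n - j) \<le> e (n - j)" "e (n - j) \<le> m" using st(1,2)[of "n - j"] by simp_all
      ultimately have "p = (v (n - (n - j)), w (m - (m - i))) \<and> n - j \<le> n \<and>
          m - i \<in> {b (n - j)..e (n - j)}" by auto
      then show "p \<in> ?A" by blast
    qed
  qed
  ultimately show ?thesis by (intro image_eqI[of _ _ ?I]) (simp_all add: I stair_simplex_def)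
qed

section \<open>Ordered simplicial complexes\<close>

text \<open>The number of strictly smaller elements is strictly increasing along a finite linear order, hence
  an order isomorphism onto an initial segment.\<close>

lemma label_order:
  assumes fin: "finite (verts \<sigma>)"
    and total: "\<And>x y. x \<in> verts \<sigma> \<Longrightarrow> y \<in> verts \<sigma> \<Longrightarrow> vle A x y \<or> vle A y x"
    and antisym: "\<And>x y. x \<in> verts \<sigma> \<Longrightarrow> y \<in> verts \<sigma> \<Longrightarrow> vle A x y \<Longrightarrow> vle A y x \<Longrightarrow> x = y"
    and trans: "\<And>x y z. x \<in> verts \<sigma> \<Longrightarrow> y \<in> verts \<sigma> \<Longrightarrow> z \<in> verts \<sigma> \<Longrightarrow> vle A x y \<Longrightarrow> vle A y z \<Longrightarrow> vle A x z"
  shows "bij_betw (label A \<sigma>) (verts \<sigma>) {..<card (verts \<sigma>)}"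
    and "\<And>x y. x \<in> verts \<sigma> \<Longrightarrow> y \<in> verts \<sigma> \<Longrightarrow> label A \<sigma> x \<le> label A \<sigma> y \<longleftrightarrow> vle A x y"
proof -
  let ?below = "\<lambda>v. {u \<in> verts \<sigma>. vle A u v \<and> u \<noteq> v}"
  have less: "label A \<sigma> x < label A \<sigma> y" if xy: "x \<in> verts \<sigma>" "y \<in> verts \<sigma>" "vle A x y" "x \<noteq> y" for x y
  proof -
    have "?below x \<subset> ?below y"
    proof
      show "?below x \<subseteq> ?below y"
        using trans[of _ x y] antisym[of x y] xy by blast
      show "?below x \<noteq> ?below y" using xy by blast
    qed
    then show ?thesis unfolding label_def by (intro psubset_card_mono) (use fin in auto)
  qed
  show le: "label A \<sigma> x \<le> label A \<sigma> y \<longleftrightarrow> vle A x y" if "x \<in> verts \<sigma>" "y \<in> verts \<sigma>" for x y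
    using less[of x y] less[of y x] total[OF that] antisym[OF that] that by fastforce
  have inj: "inj_on (label A \<sigma>) (verts \<sigma>)"
    using le antisym by (intro inj_onI) (metis order.refl)
  have "label A \<sigma> ` verts \<sigma> \<subseteq> {..<card (verts \<sigma>)}"
  proof clarify
    fix v assume "v \<in> verts \<sigma>"
    then show "label A \<sigma> v < card (verts \<sigma>)"
      unfolding label_def by (intro psubset_card_mono) (use fin in auto)
  qed
  then have "label A \<sigma> ` verts \<sigma> = {..<card (verts \<sigma>)}"
    by (intro card_subset_eq) (simp_all add: card_image[OF inj])
  with inj show "bij_betw (label A \<sigma>) (verts \<sigma>) {..<card (verts \<sigma>)}" by (simp add: bij_betw_def)
qed

locale oriented_complex =
  fixes K :: "'a::euclidean_space set set" and A :: "('a \<times> 'a) set"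
  assumes complex: "simplicial_complex K" and orientation: "edge_orientation K A"
    and acyclic: "no_cyclic_triangle K A"
begin

lemma face_in: "\<sigma> \<in> K \<Longrightarrow> F face_of \<sigma> \<Longrightarrow> F \<in> K"
  using complex unfolding simplicial_complex_def by blast

lemma hull_of_vertices_in:
  assumes "\<sigma> \<in> K" "int n simplex \<sigma>" "X \<subseteq> verts \<sigma>"
  shows "convex hull X \<in> K" "\<not> affine_dependent X"
proof -
  note s = simplex_verts[OF assms(2)]
  have "convex hull X face_of convex hull (verts \<sigma>)"
    using face_of_independent_hull_iff[OF s(1)] assms(3) by blast
  then show "convex hull X \<in> K" using face_in[OF assms(1)] s(2) by simp
  show "\<not> affine_dependent X" using affine_independent_subset[OF s(1) assms(3)] .
qed

lemma nonempty_simplex: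
  assumes "\<sigma> \<in> K" "\<sigma> \<noteq> {}"
  obtains n where "int n simplex \<sigma>"
proof -
  obtain k where k: "k simplex \<sigma>" using complex assms(1) unfolding simplicial_complex_def by blast
  then have "k \<ge> -1" "k \<noteq> -1" using simplex_dim_ge assms(2) by auto
  then have "int (nat k) simplex \<sigma>" using k by simp
  then show thesis by (rule that)
qed

context
  fixes \<sigma> n assumes \<sigma>: "\<sigma> \<in> K" "int n simplex \<sigma>"
begin

lemma edge: "x \<in> verts \<sigma> \<Longrightarrow> y \<in> verts \<sigma> \<Longrightarrow> x \<noteq> y \<Longrightarrow> (x, y) \<in> A \<longleftrightarrow> (y, x) \<notin> A"
  using orientation hull_of_vertices_in(1)[OF \<sigma>, of "{x, y}"]
  unfolding edge_orientation_def segment_convex_hull by simp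

lemma vle_total: "x \<in> verts \<sigma> \<Longrightarrow> y \<in> verts \<sigma> \<Longrightarrow> vle A x y \<or> vle A y x"
  using edge[of x y] unfolding vle_def by blast

lemma vle_antisym: "x \<in> verts \<sigma> \<Longrightarrow> y \<in> verts \<sigma> \<Longrightarrow> vle A x y \<Longrightarrow> vle A y x \<Longrightarrow> x = y"
  using edge[of x y] unfolding vle_def by blast

text \<open>If transitivity failed at three distinct vertices, the triangle spanned by them, which is a face of
  \<open>\<sigma>\<close>, would be an oriented cycle.\<close>

lemma vle_trans:
  assumes "x \<in> verts \<sigma>" "y \<in> verts \<sigma>" "z \<in> verts \<sigma>" "vle A x y" "vle A y z"
  shows "vle A x z"
proof (cases "x = y \<or> y = z \<or> x = z")
  case True
  then show ?thesis using assms by (auto simp: vle_def)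
next
  case False
  have X: "{x, y, z} \<subseteq> verts \<sigma>" using assms by simp
  have "2 simplex convex hull {x, y, z}"
    using hull_of_vertices_in(2)[OF \<sigma> X] False by (intro simplex_convex_hull) simp
  then have "(z, x) \<notin> A"
    using acyclic hull_of_vertices_in(1)[OF \<sigma> X] assms(4,5) False
    unfolding no_cyclic_triangle_def vle_def by blast
  then show ?thesis using edge[of x z] assms False unfolding vle_def by blast
qed

lemma label_bij: "bij_betw (label A \<sigma>) (verts \<sigma>) {..n}"
  and label_le_iff: "x \<in> verts \<sigma> \<Longrightarrow> y \<in> verts \<sigma> \<Longrightarrow> label A \<sigma> x \<le> label A \<sigma> y \<longleftrightarrow> vle A x y"
  using label_order[OF simplex_verts(3)[OF \<sigma>(2)] vle_total vle_antisym vle_trans]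
  by (simp_all add: simplex_verts(4)[OF \<sigma>(2)] lessThan_Suc_atMost)

lemma vertex_at_bij: "bij_betw (vertex_at A \<sigma>) {..n} (verts \<sigma>)"
  unfolding vertex_at_def by (rule bij_betw_inv_into[OF label_bij])

lemma label_vertex_at: "j \<le> n \<Longrightarrow> label A \<sigma> (vertex_at A \<sigma> j) = j"
  unfolding vertex_at_def using bij_betw_inv_into_right[OF label_bij] by simp

lemma vertex_at_label: "x \<in> verts \<sigma> \<Longrightarrow> vertex_at A \<sigma> (label A \<sigma> x) = x"
  unfolding vertex_at_def using bij_betw_inv_into_left[OF label_bij] by simp

lemma label_le: "x \<in> verts \<sigma> \<Longrightarrow> label A \<sigma> x \<le> n"
  using label_bij by (auto simp: bij_betw_def)

lemma vertex_at_in: "j \<le> n \<Longrightarrow> vertex_at A \<sigma> j \<in> verts \<sigma>"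
  using vertex_at_bij by (auto simp: bij_betw_def)

lemma vertex_at_le_iff: "j \<le> n \<Longrightarrow> j' \<le> n \<Longrightarrow> vle A (vertex_at A \<sigma> j) (vertex_at A \<sigma> j') \<longleftrightarrow> j \<le> j'"
  using label_le_iff[of "vertex_at A \<sigma> j" "vertex_at A \<sigma> j'"] by (simp add: vertex_at_in label_vertex_at)

lemma vertex_at_simplex:
  "inj_on (vertex_at A \<sigma>) {..n}" "\<not> affine_dependent (vertex_at A \<sigma> ` {..n})"
  "convex hull (vertex_at A \<sigma> ` {..n}) = \<sigma>"
  using vertex_at_bij simplex_verts[OF \<sigma>(2)] by (auto simp: bij_betw_def)

lemma is_least_iff: "is_least A \<sigma> u \<longleftrightarrow> u = vertex_at A \<sigma> 0"
proof
  assume "is_least A \<sigma> u"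
  then show "u = vertex_at A \<sigma> 0"
    using label_le_iff[of u "vertex_at A \<sigma> 0"] vertex_at_label[of u]
    by (simp add: is_least_def vertex_at_in label_vertex_at)
next
  assume "u = vertex_at A \<sigma> 0"
  then show "is_least A \<sigma> u"
    using label_le_iff[of u] by (auto simp: is_least_def vertex_at_in label_vertex_at)
qed

lemma is_biggest_iff: "is_biggest A \<sigma> u \<longleftrightarrow> u = vertex_at A \<sigma> n"
proof
  assume "is_biggest A \<sigma> u"
  then show "u = vertex_at A \<sigma> n"
    using label_le_iff[of "vertex_at A \<sigma> n" u] vertex_at_label[of u] label_le[of u]
    by (simp add: is_biggest_def vertex_at_in label_vertex_at)
next
  assume "u = vertex_at A \<sigma> n"
  then show "is_biggest A \<sigma> u"
    using label_le_iff[of _ u] label_le by (auto simp: is_biggest_def vertex_at_in label_vertex_at)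
qed

end

lemma removed_labels_eq:
  assumes "underlying t \<in> K" "int n simplex underlying t"
  shows "removed_labels A t =
    {j \<in> {..n}. opposite_facet (underlying t) (vertex_at A (underlying t) j) \<in> removed t}"
proof (intro set_eqI iffI)
  fix j assume "j \<in> removed_labels A t"
  then show "j \<in> {j \<in> {..n}. opposite_facet (underlying t) (vertex_at A (underlying t) j) \<in> removed t}"
    using vertex_at_label[OF assms] label_le[OF assms] by (auto simp: removed_labels_def)
next
  fix j assume "j \<in> {j \<in> {..n}. opposite_facet (underlying t) (vertex_at A (underlying t) j) \<in> removed t}"
  then show "j \<in> removed_labels A t"
    unfolding removed_labels_def
    by (intro image_eqI[of _ _ "vertex_at A (underlying t) j"])
      (use vertex_at_in[OF assms] label_vertex_at[OF assms] in auto)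
qed

lemma least_deprived_iff:
  assumes "underlying t \<in> K" "int n simplex underlying t"
  shows "least_deprived A t \<longleftrightarrow> 0 \<in> removed_labels A t"
  by (simp add: least_deprived_def is_least_iff[OF assms] removed_labels_eq[OF assms])

lemma biggest_deprived_iff:
  assumes "underlying t \<in> K" "int n simplex underlying t"
  shows "biggest_deprived A t \<longleftrightarrow> n \<in> removed_labels A t"
  by (simp add: biggest_deprived_def is_biggest_iff[OF assms] removed_labels_eq[OF assms])

end

section \<open>The product complex\<close>

locale oriented_pair = left: oriented_complex K1 A1 + right: oriented_complex K2 A2
  for K1 :: "'a::euclidean_space set set" and A1 and K2 :: "'b::euclidean_space set set" and A2
begin

definition vertex_chain :: "('a \<times> 'b) set \<Rightarrow> bool" where
  "vertex_chain W \<longleftrightarrow> (\<forall>(a, b)\<in>W. \<forall>(a', b')\<in>W.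
     (vle A1 a a' \<and> vle A2 b b') \<or> (vle A1 a' a \<and> vle A2 b' b))"

context
  fixes \<sigma> n \<tau> m
  assumes \<sigma>: "\<sigma> \<in> K1" "int n simplex \<sigma>" and \<tau>: "\<tau> \<in> K2" "int m simplex \<tau>"
begin

lemma is_simplex_pair: "simplex_pair n m (vertex_at A1 \<sigma>) (vertex_at A2 \<tau>)"
  using left.vertex_at_simplex[OF \<sigma>] right.vertex_at_simplex[OF \<tau>] by (simp add: simplex_pair_def)

lemma grid_image:
  "D \<subseteq> {..n} \<times> {..m} \<Longrightarrow> map_prod (vertex_at A1 \<sigma>) (vertex_at A2 \<tau>) ` D \<subseteq> verts \<sigma> \<times> verts \<tau>"
  using left.vertex_at_in[OF \<sigma>] right.vertex_at_in[OF \<tau>] by auto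

lemma chain_image:
  assumes D: "D \<subseteq> {..n} \<times> {..m}" "stair_chain D"
  shows "vertex_chain (map_prod (vertex_at A1 \<sigma>) (vertex_at A2 \<tau>) ` D)"
proof -
  have "(vle A1 (vertex_at A1 \<sigma> j) (vertex_at A1 \<sigma> j') \<and> vle A2 (vertex_at A2 \<tau> i) (vertex_at A2 \<tau> i')) \<or>
      (vle A1 (vertex_at A1 \<sigma> j') (vertex_at A1 \<sigma> j) \<and> vle A2 (vertex_at A2 \<tau> i') (vertex_at A2 \<tau> i))"
    if ji: "(j, i) \<in> D" "(j', i') \<in> D" for j i j' i'
  proof -
    have "j < j' \<longrightarrow> i \<le> i'" "j' < j \<longrightarrow> i' \<le> i" using D(2) ji unfolding stair_chain_def by blast+
    then have "(j \<le> j' \<and> i \<le> i') \<or> (j' \<le> j \<and> i' \<le> i)" by linarith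
    moreover have "j \<le> n" "j' \<le> n" "i \<le> m" "i' \<le> m" using D(1) ji by auto
    ultimately show ?thesis using left.vertex_at_le_iff[OF \<sigma>] right.vertex_at_le_iff[OF \<tau>] by simp
  qed
  then show ?thesis unfolding vertex_chain_def by fast
qed

lemma vertex_chainE:
  assumes W: "W \<subseteq> verts \<sigma> \<times> verts \<tau>" "vertex_chain W"
  obtains D where "D \<subseteq> {..n} \<times> {..m}" "stair_chain D" "W = map_prod (vertex_at A1 \<sigma>) (vertex_at A2 \<tau>) ` D"
proof
  define L where "L = map_prod (label A1 \<sigma>) (label A2 \<tau>)"
  show "L ` W \<subseteq> {..n} \<times> {..m}"
    using W(1) left.label_le[OF \<sigma>] right.label_le[OF \<tau>] by (auto simp: L_def)
  have "map_prod (vertex_at A1 \<sigma>) (vertex_at A2 \<tau>) (L c) = c" if "c \<in> W" for c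
    using that W(1) left.vertex_at_label[OF \<sigma>] right.vertex_at_label[OF \<tau>]
    by (cases c) (auto simp: L_def)
  then show "W = map_prod (vertex_at A1 \<sigma>) (vertex_at A2 \<tau>) ` L ` W" by (force simp: image_image)
  show "stair_chain (L ` W)"
    unfolding stair_chain_def
  proof (intro allI impI, elim conjE)
    fix j i j' i' assume "(j, i) \<in> L ` W" "(j', i') \<in> L ` W" and less: "j < j'"
    then obtain a b a' b' where ab: "(a, b) \<in> W" "(a', b') \<in> W"
      "j = label A1 \<sigma> a" "i = label A2 \<tau> b" "j' = label A1 \<sigma> a'" "i' = label A2 \<tau> b'"
      by (auto simp: L_def)
    then have "a \<in> verts \<sigma>" "a' \<in> verts \<sigma>" "b \<in> verts \<tau>" "b' \<in> verts \<tau>" using W(1) by auto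
    moreover have "(vle A1 a a' \<and> vle A2 b b') \<or> (vle A1 a' a \<and> vle A2 b' b)"
      using W(2) ab(1,2) unfolding vertex_chain_def by fast
    ultimately show "i \<le> i'"
      using less left.label_le_iff[OF \<sigma>] right.label_le_iff[OF \<tau>] unfolding ab(3-6) by (metis not_le)
  qed
qed

lemma chain_hull_subset:
  assumes "W \<subseteq> verts \<sigma> \<times> verts \<tau>"
  shows "convex hull W \<subseteq> \<sigma> \<times> \<tau>"
proof -
  have "convex hull W \<subseteq> (convex hull (verts \<sigma>)) \<times> (convex hull (verts \<tau>))"
    unfolding convex_hull_Times[symmetric] by (rule hull_mono[OF assms])
  then show ?thesis using simplex_verts(2)[OF \<sigma>(2)] simplex_verts(2)[OF \<tau>(2)] by simp
qed

lemma vertex_chain_independent: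
  assumes "W \<subseteq> verts \<sigma> \<times> verts \<tau>" "vertex_chain W"
  shows "\<not> affine_dependent W"
  using vertex_chainE[OF assms] simplex_pair.chain_independent[OF is_simplex_pair] by metis

text \<open>The carrier of \<open>z\<close>, expressed by vertices instead of labels: this form makes sense independently of
  the simplices and can be compared between different products.\<close>

lemma minimal_chain_exists:
  assumes "z \<in> \<sigma> \<times> \<tau>"
  obtains W where "W \<subseteq> verts \<sigma> \<times> verts \<tau>" "vertex_chain W" "z \<in> convex hull W"
    "\<And>W'. W' \<subseteq> verts \<sigma> \<times> verts \<tau> \<Longrightarrow> vertex_chain W' \<Longrightarrow> z \<in> convex hull W' \<Longrightarrow> W \<subseteq> W'"
proof -
  interpret simplex_pair n m "vertex_at A1 \<sigma>" "vertex_at A2 \<tau>" by (rule is_simplex_pair)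
  obtain C where C: "carries z C"
    using carrier_exists[of "fst z" "snd z"] assms left.vertex_at_simplex(3)[OF \<sigma>]
      right.vertex_at_simplex(3)[OF \<tau>] by (auto simp: mem_Times_iff)
  show thesis
  proof (rule that[of "vertex ` C"])
    show "vertex ` C \<subseteq> verts \<sigma> \<times> verts \<tau>" by (rule grid_image[OF carries_grid[OF C]])
    show "vertex_chain (vertex ` C)" by (rule chain_image[OF carries_grid[OF C] carries_chain[OF C]])
    show "z \<in> convex hull (vertex ` C)" by (rule carries_hull[OF C])
    fix W' assume W': "W' \<subseteq> verts \<sigma> \<times> verts \<tau>" "vertex_chain W'" "z \<in> convex hull W'"
    then obtain D where D: "D \<subseteq> {..n} \<times> {..m}" "stair_chain D" "W' = vertex ` D"
      using vertex_chainE by metis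
    then have "C \<subseteq> D" using carries_in_hull_iff[OF C D(1,2)] W'(3) by simp
    then show "vertex ` C \<subseteq> W'" using D(3) by blast
  qed
qed

text \<open>The faces of the staircase simplices are the hulls of all chains, because every chain extends to a
  staircase.\<close>

lemma face_of_stair_simplex_iff:
  "(\<exists>I\<in>staircases n m. F face_of stair_simplex n (vertex_at A1 \<sigma>) (vertex_at A2 \<tau>) I) \<longleftrightarrow>
   (\<exists>W\<subseteq>verts \<sigma> \<times> verts \<tau>. vertex_chain W \<and> F = convex hull W)"
proof -
  interpret simplex_pair n m "vertex_at A1 \<sigma>" "vertex_at A2 \<tau>" by (rule is_simplex_pair)
  have face: "F face_of stair_simplex n (vertex_at A1 \<sigma>) (vertex_at A2 \<tau>) I \<longleftrightarrow>
      (\<exists>C\<subseteq>vertex ` cells n I. F = convex hull C)"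
    if "I \<in> staircases n m" for I
    unfolding stair_simplex_hull
    by (rule face_of_independent_hull_iff[OF chain_independent[OF cells_subset[OF that] cells_chain[OF that]]])
  show ?thesis
  proof
    assume "\<exists>I\<in>staircases n m. F face_of stair_simplex n (vertex_at A1 \<sigma>) (vertex_at A2 \<tau>) I"
    then obtain I C where I: "I \<in> staircases n m" and C: "C \<subseteq> vertex ` cells n I" "F = convex hull C"
      using face by blast
    then obtain D where D: "D \<subseteq> cells n I" "C = vertex ` D" by (metis subset_image_iff)
    then have "D \<subseteq> grid" "stair_chain D"
      using cells_subset[OF I] stair_chain_subset[OF cells_chain[OF I]] by blast+
    then show "\<exists>W\<subseteq>verts \<sigma> \<times> verts \<tau>. vertex_chain W \<and> F = convex hull W"
      using grid_image chain_image C(2) D(2) by blast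
  next
    assume "\<exists>W\<subseteq>verts \<sigma> \<times> verts \<tau>. vertex_chain W \<and> F = convex hull W"
    then obtain D where D: "D \<subseteq> grid" "stair_chain D" "F = convex hull (vertex ` D)"
      using vertex_chainE by metis
    let ?I = "chain_staircase n m D"
    have "?I \<in> staircases n m" by (rule chain_staircase[OF D(1)])
    moreover have "vertex ` D \<subseteq> vertex ` cells n ?I"
      by (rule image_mono[OF chain_staircase_cells[OF D(1,2)]])
    ultimately show "\<exists>I\<in>staircases n m. F face_of stair_simplex n (vertex_at A1 \<sigma>) (vertex_at A2 \<tau>) I"
      using face D(3) by blast
  qed
qed

end

lemma product_complex_iff:
  "F \<in> product_complex K1 A1 K2 A2 \<longleftrightarrow>
   (\<exists>\<sigma> n \<tau> m W. \<sigma> \<in> K1 \<and> int n simplex \<sigma> \<and> \<tau> \<in> K2 \<and> int m simplex \<tau> \<and>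
      W \<subseteq> verts \<sigma> \<times> verts \<tau> \<and> vertex_chain W \<and> F = convex hull W)"
proof -
  have "F \<in> product_complex K1 A1 K2 A2 \<longleftrightarrow>
    (\<exists>\<sigma> n \<tau> m. \<sigma> \<in> K1 \<and> int n simplex \<sigma> \<and> \<tau> \<in> K2 \<and> int m simplex \<tau> \<and>
      (\<exists>I\<in>staircases n m. F face_of stair_simplex n (vertex_at A1 \<sigma>) (vertex_at A2 \<tau>) I))"
    unfolding product_complex_def by blast
  also have "\<dots> \<longleftrightarrow> (\<exists>\<sigma> n \<tau> m. \<sigma> \<in> K1 \<and> int n simplex \<sigma> \<and> \<tau> \<in> K2 \<and> int m simplex \<tau> \<and>
      (\<exists>W\<subseteq>verts \<sigma> \<times> verts \<tau>. vertex_chain W \<and> F = convex hull W))"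
    by (simp add: face_of_stair_simplex_iff cong: conj_cong)
  finally show ?thesis by blast
qed

text \<open>Let \<open>W0\<close> be the minimal chain of \<open>z\<close> in the product of the common faces of the two pairs. Its
  vertices belong to both pairs, so the minimal chain with respect to either pair is contained in
  \<open>W0\<close>; it is then a chain in the common faces and contains \<open>W0\<close> by minimality. So \<open>W0\<close> lies in
  both \<open>W\<close> and \<open>W'\<close>.\<close>

lemma chain_hulls_intersect:
  assumes \<sigma>: "\<sigma> \<in> K1" "int n simplex \<sigma>" and \<tau>: "\<tau> \<in> K2" "int m simplex \<tau>"
    and \<sigma>': "\<sigma>' \<in> K1" "int n' simplex \<sigma>'" and \<tau>': "\<tau>' \<in> K2" "int m' simplex \<tau>'"
    and W: "W \<subseteq> verts \<sigma> \<times> verts \<tau>" "vertex_chain W"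
    and W': "W' \<subseteq> verts \<sigma>' \<times> verts \<tau>'" "vertex_chain W'"
  shows "convex hull W \<inter> convex hull W' = convex hull (W \<inter> W')"
proof
  show "convex hull (W \<inter> W') \<subseteq> convex hull W \<inter> convex hull W'"
    by (simp add: hull_mono)
  show "convex hull W \<inter> convex hull W' \<subseteq> convex hull (W \<inter> W')"
  proof
    fix z assume z: "z \<in> convex hull W \<inter> convex hull W'"
    then have z1: "z \<in> \<sigma> \<times> \<tau>" "z \<in> \<sigma>' \<times> \<tau>'"
      using chain_hull_subset[OF \<sigma> \<tau> W(1)] chain_hull_subset[OF \<sigma>' \<tau>' W'(1)] by blast+
    then have z0: "z \<in> (\<sigma> \<inter> \<sigma>') \<times> (\<tau> \<inter> \<tau>')" by auto
    have f1: "\<sigma> \<inter> \<sigma>' face_of \<sigma>" "\<sigma> \<inter> \<sigma>' face_of \<sigma>'"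
      using left.complex \<sigma>(1) \<sigma>'(1) unfolding simplicial_complex_def by (metis Int_commute)+
    have f2: "\<tau> \<inter> \<tau>' face_of \<tau>" "\<tau> \<inter> \<tau>' face_of \<tau>'"
      using right.complex \<tau>(1) \<tau>'(1) unfolding simplicial_complex_def by (metis Int_commute)+
    have in1: "\<sigma> \<inter> \<sigma>' \<in> K1" and in2: "\<tau> \<inter> \<tau>' \<in> K2"
      using left.face_in[OF \<sigma>(1) f1(1)] right.face_in[OF \<tau>(1) f2(1)] .
    obtain n0 where n0: "int n0 simplex \<sigma> \<inter> \<sigma>'" using left.nonempty_simplex[OF in1] z0 by blast
    obtain m0 where m0: "int m0 simplex \<tau> \<inter> \<tau>'" using right.nonempty_simplex[OF in2] z0 by blast
    obtain W0 where W0: "W0 \<subseteq> verts (\<sigma> \<inter> \<sigma>') \<times> verts (\<tau> \<inter> \<tau>')" "vertex_chain W0" "z \<in> convex hull W0"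
      and min0: "\<And>W'. W' \<subseteq> verts (\<sigma> \<inter> \<sigma>') \<times> verts (\<tau> \<inter> \<tau>') \<Longrightarrow> vertex_chain W' \<Longrightarrow>
        z \<in> convex hull W' \<Longrightarrow> W0 \<subseteq> W'"
      using minimal_chain_exists[OF in1 n0 in2 m0 z0] by metis
    have sub: "W0 \<subseteq> V"
      if s: "s \<in> K1" "int k simplex s" and t: "t \<in> K2" "int l simplex t"
        and face: "\<sigma> \<inter> \<sigma>' face_of s" "\<tau> \<inter> \<tau>' face_of t"
        and V: "V \<subseteq> verts s \<times> verts t" "vertex_chain V" "z \<in> convex hull V" for s k t l V
    proof -
      have "verts (\<sigma> \<inter> \<sigma>') \<times> verts (\<tau> \<inter> \<tau>') \<subseteq> verts s \<times> verts t"
        using extreme_point_of_face[OF face(1)] extreme_point_of_face[OF face(2)]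
        unfolding verts_def by blast
      then have W0': "W0 \<subseteq> verts s \<times> verts t" using W0(1) by blast
      have "z \<in> s \<times> t" using chain_hull_subset[OF s t V(1)] V(3) by blast
      then obtain W1 where W1: "vertex_chain W1" "z \<in> convex hull W1"
        and min1: "\<And>W'. W' \<subseteq> verts s \<times> verts t \<Longrightarrow> vertex_chain W' \<Longrightarrow> z \<in> convex hull W' \<Longrightarrow> W1 \<subseteq> W'"
        using minimal_chain_exists[OF s t] by metis
      have "W1 \<subseteq> W0" using min1[OF W0' W0(2,3)] .
      then have "W0 \<subseteq> W1" using min0 W0(1) W1 by blast
      also have "W1 \<subseteq> V" using min1[OF V] .
      finally show ?thesis .
    qed
    have "W0 \<subseteq> W" using sub[OF \<sigma> \<tau> f1(1) f2(1) W] z by blast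
    moreover have "W0 \<subseteq> W'" using sub[OF \<sigma>' \<tau>' f1(2) f2(2) W'] z by blast
    ultimately show "z \<in> convex hull (W \<inter> W')" using W0(3) hull_mono[of W0 "W \<inter> W'"] by blast
  qed
qed

lemma simplicial_complex_product: "simplicial_complex (product_complex K1 A1 K2 A2)"
  unfolding simplicial_complex_def
proof (intro conjI ballI allI impI)
  let ?K = "product_complex K1 A1 K2 A2"
  show "finite ?K"
  proof (rule finite_subset)
    show "?K \<subseteq> (\<Union>\<sigma>\<in>{\<sigma> \<in> K1. finite (verts \<sigma>)}. \<Union>\<tau>\<in>{\<tau> \<in> K2. finite (verts \<tau>)}.
        (\<lambda>W. convex hull W) ` Pow (verts \<sigma> \<times> verts \<tau>))"
    proof
      fix F assume "F \<in> ?K"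
      then obtain \<sigma> n \<tau> m W where \<sigma>: "\<sigma> \<in> K1" "int n simplex \<sigma>" and \<tau>: "\<tau> \<in> K2" "int m simplex \<tau>"
        and W: "W \<subseteq> verts \<sigma> \<times> verts \<tau>" "F = convex hull W"
        unfolding product_complex_iff by blast
      then show "F \<in> (\<Union>\<sigma>\<in>{\<sigma> \<in> K1. finite (verts \<sigma>)}. \<Union>\<tau>\<in>{\<tau> \<in> K2. finite (verts \<tau>)}.
        (\<lambda>W. convex hull W) ` Pow (verts \<sigma> \<times> verts \<tau>))"
        using simplex_verts(3)[OF \<sigma>(2)] simplex_verts(3)[OF \<tau>(2)] by blast
    qed
    show "finite \<dots>"
      using left.complex right.complex by (auto simp: simplicial_complex_def)
  qed
  show "\<exists>n. n simplex F" if F: "F \<in> ?K" for F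
  proof -
    obtain \<sigma> n \<tau> m W where \<sigma>: "\<sigma> \<in> K1" "int n simplex \<sigma>" and \<tau>: "\<tau> \<in> K2" "int m simplex \<tau>"
      and W: "W \<subseteq> verts \<sigma> \<times> verts \<tau>" "vertex_chain W" "F = convex hull W"
      using F unfolding product_complex_iff by blast
    have "int (card W) - 1 simplex F"
      unfolding W(3) using vertex_chain_independent[OF \<sigma> \<tau> W(1,2)] by (intro simplex_convex_hull) simp
    then show ?thesis ..
  qed
  show "F \<in> ?K" if FG: "G \<in> ?K \<and> F face_of G" for F G
  proof -
    obtain \<sigma> n \<tau> m W where \<sigma>: "\<sigma> \<in> K1" "int n simplex \<sigma>" and \<tau>: "\<tau> \<in> K2" "int m simplex \<tau>"
      and W: "W \<subseteq> verts \<sigma> \<times> verts \<tau>" "vertex_chain W" "G = convex hull W"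
      using FG unfolding product_complex_iff by blast
    obtain W' where W': "W' \<subseteq> W" "F = convex hull W'"
      using FG face_of_independent_hull_iff[OF vertex_chain_independent[OF \<sigma> \<tau> W(1,2)]] W(3) by blast
    moreover have "vertex_chain W'" using W(2) W'(1) unfolding vertex_chain_def by blast
    ultimately show ?thesis
      unfolding product_complex_iff using \<sigma> \<tau> W(1) by blast
  qed
  show "F \<inter> G face_of F" if FG: "F \<in> ?K \<and> G \<in> ?K" for F G
  proof -
    obtain \<sigma> n \<tau> m W where \<sigma>: "\<sigma> \<in> K1" "int n simplex \<sigma>" and \<tau>: "\<tau> \<in> K2" "int m simplex \<tau>"
      and W: "W \<subseteq> verts \<sigma> \<times> verts \<tau>" "vertex_chain W" "F = convex hull W"
      using FG unfolding product_complex_iff by blast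
    obtain \<sigma>' n' \<tau>' m' W' where \<sigma>': "\<sigma>' \<in> K1" "int n' simplex \<sigma>'" and \<tau>': "\<tau>' \<in> K2" "int m' simplex \<tau>'"
      and W': "W' \<subseteq> verts \<sigma>' \<times> verts \<tau>'" "vertex_chain W'" "G = convex hull W'"
      using FG unfolding product_complex_iff by blast
    have "F \<inter> G = convex hull (W \<inter> W')"
      unfolding W(3) W'(3) by (rule chain_hulls_intersect[OF \<sigma> \<tau> \<sigma>' \<tau>' W(1,2) W'(1,2)])
    then show ?thesis
      unfolding W(3) using face_of_independent_hull_iff[OF vertex_chain_independent[OF \<sigma> \<tau> W(1,2)]]
      by blast
  qed
qed

lemma Union_product_complex: "\<Union> (product_complex K1 A1 K2 A2) = \<Union> K1 \<times> \<Union> K2"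
proof
  show "\<Union> (product_complex K1 A1 K2 A2) \<subseteq> \<Union> K1 \<times> \<Union> K2"
  proof
    fix z assume "z \<in> \<Union> (product_complex K1 A1 K2 A2)"
    then obtain F where F: "F \<in> product_complex K1 A1 K2 A2" "z \<in> F" by blast
    then obtain \<sigma> n \<tau> m W where \<sigma>: "\<sigma> \<in> K1" "int n simplex \<sigma>" and \<tau>: "\<tau> \<in> K2" "int m simplex \<tau>"
      and W: "W \<subseteq> verts \<sigma> \<times> verts \<tau>" "F = convex hull W"
      unfolding product_complex_iff by blast
    then have "z \<in> \<sigma> \<times> \<tau>" using chain_hull_subset[OF \<sigma> \<tau> W(1)] F(2) by blast
    then show "z \<in> \<Union> K1 \<times> \<Union> K2" using \<sigma>(1) \<tau>(1) by blast
  qed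
  show "\<Union> K1 \<times> \<Union> K2 \<subseteq> \<Union> (product_complex K1 A1 K2 A2)"
  proof
    fix z assume "z \<in> \<Union> K1 \<times> \<Union> K2"
    then obtain \<sigma> \<tau> where st: "\<sigma> \<in> K1" "\<tau> \<in> K2" "z \<in> \<sigma> \<times> \<tau>" by auto
    obtain n where n: "int n simplex \<sigma>" using left.nonempty_simplex[OF st(1)] st(3) by blast
    obtain m where m: "int m simplex \<tau>" using right.nonempty_simplex[OF st(2)] st(3) by blast
    obtain W where "W \<subseteq> verts \<sigma> \<times> verts \<tau>" "vertex_chain W" "z \<in> convex hull W"
      using minimal_chain_exists[OF st(1) n st(2) m st(3)] by metis
    moreover from this have "convex hull W \<in> product_complex K1 A1 K2 A2"
      unfolding product_complex_iff using st n m by blast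
    ultimately show "z \<in> \<Union> (product_complex K1 A1 K2 A2)" by blast
  qed
qed

end

section \<open>The product tiling\<close>

lemma tile_dim_basic: "basic_tile n k t \<Longrightarrow> tile_dim t = n"
  using aff_dim_simplex[of "int n" "underlying t"] by (simp add: tile_dim_def basic_tile_def)

context oriented_pair
begin

text \<open>Write \<open>a, a'\<close> for membership of the last and the first label in \<open>J1\<close>, and \<open>b, b'\<close> for \<open>J2\<close>. If the
  first case of the construction fails, then \<open>a \<and> \<not> b\<close> or \<open>b' \<and> \<not> a'\<close>. The second case needs
  \<open>a' \<longrightarrow> b'\<close> and \<open>b \<longrightarrow> a\<close>. Under \<open>a \<and> \<not> b\<close> only the former is in question, and \<open>a \<and> a'\<close> gives
  \<open>b \<or> b'\<close>; under \<open>b' \<and> \<not> a'\<close> only the latter, and \<open>b \<and> b'\<close> gives \<open>a \<or> a'\<close>.\<close>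

lemma product_pieces_tile:
  assumes t: "underlying t \<in> K1" "basic_tile n k t" and t': "underlying t' \<in> K2" "basic_tile m k' t'"
    and both: "biggest_deprived A1 t \<and> least_deprived A1 t \<Longrightarrow> biggest_deprived A2 t' \<or> least_deprived A2 t'"
    and both': "biggest_deprived A2 t' \<and> least_deprived A2 t' \<Longrightarrow> biggest_deprived A1 t \<or> least_deprived A1 t"
  shows "\<exists>\<T>. tiles_product (product_complex K1 A1 K2 A2) (points t \<times> points t') (n + m)
    (product_pieces A1 t A2 t') \<T>"
proof -
  let ?v = "vertex_at A1 (underlying t)" and ?w = "vertex_at A2 (underlying t')"
  let ?J1 = "removed_labels A1 t" and ?J2 = "removed_labels A2 t'"
  have s: "int n simplex underlying t" "int m simplex underlying t'"
    using t(2) t'(2) by (simp_all add: basic_tile_def)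
  have dim: "tile_dim t = n" "tile_dim t' = m"
    using tile_dim_basic t(2) t'(2) by blast+
  note v = left.vertex_at_bij[OF t(1) s(1)] and w = right.vertex_at_bij[OF t'(1) s(2)]
  have J: "n \<in> ?J1 \<and> 0 \<in> ?J1 \<Longrightarrow> m \<in> ?J2 \<or> 0 \<in> ?J2" "m \<in> ?J2 \<and> 0 \<in> ?J2 \<Longrightarrow> n \<in> ?J1 \<or> 0 \<in> ?J1"
    using both both' left.least_deprived_iff[OF t(1) s(1)] left.biggest_deprived_iff[OF t(1) s(1)]
      right.least_deprived_iff[OF t'(1) s(2)] right.biggest_deprived_iff[OF t'(1) s(2)] by blast+
  have K: "stair_simplex n ?v ?w I \<in> product_complex K1 A1 K2 A2" if "I \<in> staircases n m" for I
  proof -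
    interpret simplex_pair n m ?v ?w by (rule is_simplex_pair[OF t(1) s(1) t'(1) s(2)])
    have "stair_simplex n ?v ?w I face_of stair_simplex n ?v ?w I"
      by (simp add: face_of_refl stair_simplex_hull)
    then show ?thesis
      unfolding product_complex_def using that t(1) t'(1) s by blast
  qed
  show ?thesis
  proof (cases "(n \<in> ?J1 \<longrightarrow> m \<in> ?J2) \<and> (0 \<in> ?J2 \<longrightarrow> 0 \<in> ?J1)")
    case True
    have "\<exists>\<T>. tiles_product (product_complex K1 A1 K2 A2) (points t \<times> points t') (n + m)
        ((\<lambda>I. stair_tile n ?v ?w I \<inter> (points t \<times> points t')) ` staircases n m) \<T>"
    proof (rule simplex_pair.stair_tiles_tile_product[of n m ?v ?w ?J1 ?J2])
      show "simplex_pair n m ?v ?w" by (rule is_simplex_pair[OF t(1) s(1) t'(1) s(2)])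
      show "?J1 \<subseteq> {..n}" "?J2 \<subseteq> {..m}"
        using left.removed_labels_eq[OF t(1) s(1)] right.removed_labels_eq[OF t'(1) s(2)] by auto
      show "points t = {x \<in> convex hull (?v ` {..n}). \<forall>j\<in>?J1. x \<notin> convex hull (?v ` ({..n} - {j}))}"
        unfolding left.removed_labels_eq[OF t(1) s(1)] by (rule points_by_vertices[OF t(2) v])
      show "points t' = {x \<in> convex hull (?w ` {..m}). \<forall>j\<in>?J2. x \<notin> convex hull (?w ` ({..m} - {j}))}"
        unfolding right.removed_labels_eq[OF t'(1) s(2)] by (rule points_by_vertices[OF t'(2) w])
    qed (use True K in auto)
    then show ?thesis by (simp only: product_pieces_def Let_def dim if_P[OF True])
  next
    case False
    let ?v' = "\<lambda>j. ?v (n - j)" and ?w' = "\<lambda>i. ?w (m - i)"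
    let ?J1' = "{j \<in> {..n}. n - j \<in> ?J1}" and ?J2' = "{i \<in> {..m}. m - i \<in> ?J2}"
    have rev: "bij_betw (\<lambda>j. l - j) {..l} {..l}" for l :: nat
      by (rule bij_betwI[where g="\<lambda>j. l - j"]) auto
    have v': "bij_betw ?v' {..n} (verts (underlying t))" and w': "bij_betw ?w' {..m} (verts (underlying t'))"
      using bij_betw_trans[OF rev v] bij_betw_trans[OF rev w] by (simp_all add: o_def)
    have J': "?J1' = {j \<in> {..n}. opposite_facet (underlying t) (?v' j) \<in> removed t}"
      "?J2' = {i \<in> {..m}. opposite_facet (underlying t') (?w' i) \<in> removed t'}"
      using left.removed_labels_eq[OF t(1) s(1)] right.removed_labels_eq[OF t'(1) s(2)] by auto
    have "\<exists>\<T>. tiles_product (product_complex K1 A1 K2 A2) (points t \<times> points t') (n + m)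
        ((\<lambda>I. stair_tile n ?v' ?w' I \<inter> (points t \<times> points t')) ` staircases n m) \<T>"
    proof (rule simplex_pair.stair_tiles_tile_product[of n m ?v' ?w' ?J1' ?J2'])
      show "simplex_pair n m ?v' ?w'"
        using v' w' simplex_verts(1)[OF s(1)] simplex_verts(1)[OF s(2)]
        by (simp add: simplex_pair_def bij_betw_def)
      show "points t = {x \<in> convex hull (?v' ` {..n}). \<forall>j\<in>?J1'. x \<notin> convex hull (?v' ` ({..n} - {j}))}"
        unfolding J' by (rule points_by_vertices[OF t(2) v'])
      show "points t' = {x \<in> convex hull (?w' ` {..m}). \<forall>j\<in>?J2'. x \<notin> convex hull (?w' ` ({..m} - {j}))}"
        unfolding J' by (rule points_by_vertices[OF t'(2) w'])
      show "n \<in> ?J1' \<longrightarrow> m \<in> ?J2'" "0 \<in> ?J2' \<longrightarrow> 0 \<in> ?J1'" using False J by auto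
      show "stair_simplex n ?v' ?w' I \<in> product_complex K1 A1 K2 A2" if "I \<in> staircases n m" for I
        using reversed_stair_simplex[OF that, of ?v ?w] K by auto
    qed auto
    then show ?thesis by (simp only: product_pieces_def Let_def dim if_not_P[OF False])
  qed
qed

end

text \<open>Pieces from different pairs of tiles are disjoint because the tiles are, and dimensions add, so
  only the closedness of the filtration needs an argument.\<close>

lemma h_tiling_product:
  assumes 1: "h_tiled_set K1 S1 \<T>1" and 2: "h_tiled_set K2 S2 \<T>2"
    and K: "simplicial_complex K" "\<Union> K = \<Union> K1 \<times> \<Union> K2"
    and F: "\<And>t t'. t \<in> \<T>1 \<Longrightarrow> t' \<in> \<T>2 \<Longrightarrow>
      tiles_product K (points t \<times> points t') (tile_dim t + tile_dim t') (\<P> t t') (\<F> t t')"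
  shows "h_tiled_set K (S1 \<times> S2) (\<Union>t\<in>\<T>1. \<Union>t'\<in>\<T>2. \<F> t t')"
    and "points ` (\<Union>t\<in>\<T>1. \<Union>t'\<in>\<T>2. \<F> t t') = (\<Union>t\<in>\<T>1. \<Union>t'\<in>\<T>2. \<P> t t')"
proof -
  let ?T = "\<Union>t\<in>\<T>1. \<Union>t'\<in>\<T>2. \<F> t t'"
  have h1: "S1 \<subseteq> \<Union>K1" "pairwise (\<lambda>t t'. disjnt (points t) (points t')) \<T>1" "\<Union> (points ` \<T>1) = S1"
      "\<And>j. closedin (top_of_set S1) (\<Union> (points ` {t\<in>\<T>1. j \<le> tile_dim t}))" "closure S1 = \<Union>K1"
    using 1 unfolding h_tiled_set_def h_tiling_def by - (elim conjE, (assumption | erule spec))+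
  have h2: "S2 \<subseteq> \<Union>K2" "pairwise (\<lambda>t t'. disjnt (points t) (points t')) \<T>2" "\<Union> (points ` \<T>2) = S2"
      "\<And>j. closedin (top_of_set S2) (\<Union> (points ` {t\<in>\<T>2. j \<le> tile_dim t}))" "closure S2 = \<Union>K2"
    using 2 unfolding h_tiled_set_def h_tiling_def by - (elim conjE, (assumption | erule spec))+
  have F_tile: "underlying s \<in> K" "\<exists>k. basic_tile (tile_dim t + tile_dim t') k s"
    if "t \<in> \<T>1" "t' \<in> \<T>2" "s \<in> \<F> t t'" for t t' s
    using F[OF that(1,2)] that(3) unfolding tiles_product_def by blast+
  have F_dim: "tile_dim s = tile_dim t + tile_dim t'" if "t \<in> \<T>1" "t' \<in> \<T>2" "s \<in> \<F> t t'" for t t' s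
    using F_tile(2)[OF that] tile_dim_basic by blast
  have F_points: "points ` \<F> t t' = \<P> t t'" "\<Union> (points ` \<F> t t') = points t \<times> points t'"
    if "t \<in> \<T>1" "t' \<in> \<T>2" for t t'
    using F[OF that] unfolding tiles_product_def by auto
  show "points ` ?T = (\<Union>t\<in>\<T>1. \<Union>t'\<in>\<T>2. \<P> t t')"
    by (simp add: image_UN F_points(1))
  have disj: "disjnt (points s) (points s')" if s: "s \<in> ?T" "s' \<in> ?T" "s \<noteq> s'" for s s'
  proof -
    obtain t t' where t: "t \<in> \<T>1" "t' \<in> \<T>2" "s \<in> \<F> t t'" using s(1) by blast
    obtain u u' where u: "u \<in> \<T>1" "u' \<in> \<T>2" "s' \<in> \<F> u u'" using s(2) by blast
    have sub: "points s \<subseteq> points t \<times> points t'" "points s' \<subseteq> points u \<times> points u'"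
      using F_points(2)[OF t(1,2)] F_points(2)[OF u(1,2)] t(3) u(3) by blast+
    show ?thesis
    proof (cases "t = u \<and> t' = u'")
      case True
      then have "s' \<in> \<F> t t'" using u by simp
      then show ?thesis using F[OF t(1,2)] t(3) s(3) unfolding tiles_product_def pairwise_def by blast
    next
      case False
      then have "disjnt (points t) (points u) \<or> disjnt (points t') (points u')"
        using h1(2) h2(2) t u unfolding pairwise_def by blast
      then show ?thesis using sub unfolding disjnt_def by blast
    qed
  qed
  have union: "\<Union> (points ` ?T) = S1 \<times> S2"
  proof -
    have "\<Union> (points ` ?T) = (\<Union>t\<in>\<T>1. \<Union>t'\<in>\<T>2. \<Union> (points ` \<F> t t'))" by blast
    also have "\<dots> = (\<Union>t\<in>\<T>1. \<Union>t'\<in>\<T>2. points t \<times> points t')" by (simp add: F_points(2))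
    also have "\<dots> = S1 \<times> S2" unfolding h1(3)[symmetric] h2(3)[symmetric] by blast
    finally show ?thesis .
  qed
  have filtration: "closedin (top_of_set (S1 \<times> S2)) (\<Union> (points ` {s \<in> ?T. j \<le> tile_dim s}))" for j
  proof -
    let ?X = "\<lambda>p. \<Union> (points ` {t\<in>\<T>1. p \<le> tile_dim t})"
    let ?Y = "\<lambda>p. \<Union> (points ` {t\<in>\<T>2. p \<le> tile_dim t})"
    \<comment> \<open>Bounding \<open>p\<close> by \<open>j\<close> keeps the union finite; for larger \<open>p\<close> the product lies in the one for \<open>p = j\<close>.\<close>
    have "\<Union> (points ` {s \<in> ?T. j \<le> tile_dim s}) = (\<Union>p\<le>j. ?X p \<times> ?Y (j - p))"
    proof (intro set_eqI iffI)
      fix z assume "z \<in> \<Union> (points ` {s \<in> ?T. j \<le> tile_dim s})"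
      then obtain t t' s where t: "t \<in> \<T>1" "t' \<in> \<T>2" "s \<in> \<F> t t'" "j \<le> tile_dim s" "z \<in> points s"
        by blast
      then have "z \<in> points t \<times> points t'" using F_points(2)[OF t(1,2)] by blast
      moreover have "min (tile_dim t) j \<le> tile_dim t" "j - min (tile_dim t) j \<le> tile_dim t'"
        using F_dim[OF t(1-3)] t(4) by auto
      ultimately have "z \<in> ?X (min (tile_dim t) j) \<times> ?Y (j - min (tile_dim t) j)"
        using t(1,2) by (cases z) auto
      then show "z \<in> (\<Union>p\<le>j. ?X p \<times> ?Y (j - p))" by (meson UN_I atMost_iff min.cobounded2)
    next
      fix z assume "z \<in> (\<Union>p\<le>j. ?X p \<times> ?Y (j - p))"
      then obtain p t t' where t: "p \<le> j" "t \<in> \<T>1" "t' \<in> \<T>2" "p \<le> tile_dim t" "j - p \<le> tile_dim t'"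
        "z \<in> points t \<times> points t'" by auto
      then obtain s where s: "s \<in> \<F> t t'" "z \<in> points s" using F_points(2)[OF t(2,3)] by blast
      have "j \<le> tile_dim s" using F_dim[OF t(2,3) s(1)] t(1,4,5) by simp
      then show "z \<in> \<Union> (points ` {s \<in> ?T. j \<le> tile_dim s})" using s t(2,3) by blast
    qed
    moreover have "closedin (top_of_set (S1 \<times> S2)) (\<Union>p\<le>j. ?X p \<times> ?Y (j - p))"
      by (intro closedin_Union) (auto intro: closedin_Times h1(4) h2(4))
    ultimately show ?thesis by simp
  qed
  have "h_tiling K (S1 \<times> S2) ?T"
    unfolding h_tiling_def
  proof (intro conjI ballI allI)
    show "S1 \<times> S2 \<subseteq> \<Union> K" using K(2) h1(1) h2(1) by auto
    show "pairwise (\<lambda>t t'. disjnt (points t) (points t')) ?T"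
      unfolding pairwise_def using disj by blast
    fix s assume "s \<in> ?T"
    then show "underlying s \<in> K" "\<exists>n k. basic_tile n k s" using F_tile by blast+
  qed (fact K(1) union filtration)+
  then show "h_tiled_set K (S1 \<times> S2) ?T"
    by (simp add: h_tiled_set_def closure_Times K(2) h1(5) h2(5))
qed

theorem theorem3p10:
  fixes K1 :: "'a::euclidean_space set set" and K2 :: "'b::euclidean_space set set"
    and S1 :: "'a set" and S2 :: "'b set"
    and \<T>1 :: "'a tile set" and \<T>2 :: "'b tile set"
    and A1 :: "('a \<times> 'a) set" and A2 :: "('b \<times> 'b) set"
  assumes "h_tiled_set K1 S1 \<T>1" and "h_tiled_set K2 S2 \<T>2"
    and "edge_orientation K1 A1" and "no_cyclic_triangle K1 A1"
    and "edge_orientation K2 A2" and "no_cyclic_triangle K2 A2"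
    and "(\<exists>t\<in>\<T>1. biggest_deprived A1 t \<and> least_deprived A1 t) \<longrightarrow>
         (\<forall>t'\<in>\<T>2. biggest_deprived A2 t' \<or> least_deprived A2 t')"
    and "(\<exists>t'\<in>\<T>2. biggest_deprived A2 t' \<and> least_deprived A2 t') \<longrightarrow>
         (\<forall>t\<in>\<T>1. biggest_deprived A1 t \<or> least_deprived A1 t)"
  shows "\<exists>\<T>. points ` \<T> = product_tiling A1 \<T>1 A2 \<T>2 \<and>
              h_tiled_set (product_complex K1 A1 K2 A2) (S1 \<times> S2) \<T>"
proof -
  have complexes: "simplicial_complex K1" "simplicial_complex K2"
    using assms(1,2) unfolding h_tiled_set_def h_tiling_def by - (elim conjE, assumption)+
  interpret oriented_pair K1 A1 K2 A2
    by (intro oriented_pair.intro oriented_complex.intro complexes assms(3-6))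
  have "\<exists>\<T>. tiles_product (product_complex K1 A1 K2 A2) (points t \<times> points t')
      (tile_dim t + tile_dim t') (product_pieces A1 t A2 t') \<T>" if t: "t \<in> \<T>1" and t': "t' \<in> \<T>2" for t t'
  proof -
    obtain n k m k' where "basic_tile n k t" "underlying t \<in> K1" "basic_tile m k' t'" "underlying t' \<in> K2"
      using assms(1)[unfolded h_tiled_set_def h_tiling_def, THEN conjunct1, THEN conjunct2, THEN conjunct2,
          THEN conjunct1, rule_format, OF t]
        assms(2)[unfolded h_tiled_set_def h_tiling_def, THEN conjunct1, THEN conjunct2, THEN conjunct2,
          THEN conjunct1, rule_format, OF t'] by blast
    moreover from this have "tile_dim t = n" "tile_dim t' = m" using tile_dim_basic by blast+
    ultimately show ?thesis using product_pieces_tile[of t n k t' m k'] assms(7,8) t t' by blast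
  qed
  then obtain \<F> where \<F>: "tiles_product (product_complex K1 A1 K2 A2) (points t \<times> points t')
      (tile_dim t + tile_dim t') (product_pieces A1 t A2 t') (\<F> t t')"
    if "t \<in> \<T>1" "t' \<in> \<T>2" for t t'
    by metis
  let ?T = "\<Union>t\<in>\<T>1. \<Union>t'\<in>\<T>2. \<F> t t'"
  note product = h_tiling_product[OF assms(1,2) simplicial_complex_product Union_product_complex]
  have "h_tiled_set (product_complex K1 A1 K2 A2) (S1 \<times> S2) ?T"
    by (rule product(1)) (rule \<F>)
  moreover have "points ` ?T = product_tiling A1 \<T>1 A2 \<T>2"
    unfolding product_tiling_def by (rule product(2)) (rule \<F>)
  ultimately show ?thesis by blast
qed

end
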